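(* Let $\varphi:\{0,1\}^*\to\{0,1\}^*$ be a primitive non-uniform morphism and let $\mathbf{u}$ be an aperiodic fixed point of $\varphi$ such that the set of factors of $\mathbf{u}$ contains infinitely many palindromes as well as infinitely many antipalindromes. Then either $\varphi$ or $\varphi^2$ is a morphism in class $\mathcal{A}_2$ for which the word $\mathfrak{w}$ in its defining representation is an antipalindrome; i.e., there exist a nonempty antipalindrome $\mathfrak{w}$ and $k,h\in\mathbb{N}$ such that $\psi(0)=\Theta\big(\mathfrak{w}(\mathrm{R}(\mathfrak{w})\mathfrak{w})^k\big)$ and $\psi(1)=\Theta\big((\mathrm{R}(\mathfrak{w})\mathfrak{w})^h\mathrm{R}(\mathfrak{w})\big)$, where $\psi=\varphi$ or $\psi=\varphi^2$.
   Context: Words are over $\{0,1\}$, $\varepsilon$ the empty word, $\mathbb{N}=\{0,1,2,\dots\}$. $\mathrm{R}$ is the mirror image antimorphism $\mathrm{R}(w_1\cdots w_n)=w_n\cdots w_1$; $w$ is a palindrome if $\mathrm{R}(w)=w$. $\mathrm{E}$ is the antimorphism $\mathrm{E}(w_1\cdots w_n)=(1-w_n)\cdots(1-w_1)$; $w$ is an antipalindrome if $\mathrm{E}(w)=w$. $\Theta$ is the Thue–Morse morphism $\Theta(0)=01$, $\Theta(1)=10$. A morphism is primitive if some power maps every letter to a word containing both letters; uniform if $|\varphi(0)|=|\varphi(1)|$. A fixed point is an infinite word $\mathbf{u}$ with $\varphi(\mathbf{u})=\mathbf{u}$; aperiodic means not eventually periodic. Class $\mathcal{A}_2$: morphisms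 $\psi$ for which there exist a nonempty word $\mathfrak{w}$ and $k,h\in\mathbb{N}$ with $\psi(0)=\Theta(\mathfrak{w}(\mathrm{R}(\mathfrak{w})\mathfrak{w})^k)$, $\psi(1)=\Theta((\mathrm{R}(\mathfrak{w})\mathfrak{w})^h\mathrm{R}(\mathfrak{w}))$. *)

theory Defs
  imports "HOL-Library.Stream"
begin

text \<open>
  The alphabet \<open>{0,1}\<close> is the type \<^typ>\<open>bool\<close>, with \<^term>\<open>False\<close> for 0 and \<^term>\<open>True\<close> for 1.
  Finite words are lists and infinite words are streams. The mirror image R is \<^const>\<open>rev\<close>;
  the antimorphism E is \<open>exchange_rev\<close> below.
\<close>

type_synonym word = "bool list"

definition palindrome :: "word \<Rightarrow> bool" where
  "palindrome w \<longleftrightarrow> rev w = w"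

definition exchange_rev :: "word \<Rightarrow> word" where
  "exchange_rev w = rev (map Not w)"

definition antipalindrome :: "word \<Rightarrow> bool" where
  "antipalindrome w \<longleftrightarrow> exchange_rev w = w"

definition thue_morse :: "word \<Rightarrow> word" where
  "thue_morse w = concat (map (\<lambda>a. if a then [True, False] else [False, True]) w)"

definition word_power :: "word \<Rightarrow> nat \<Rightarrow> word" where
  "word_power w n = concat (replicate n w)"

definition morphism :: "(word \<Rightarrow> word) \<Rightarrow> bool" where
  "morphism \<phi> \<longleftrightarrow> (\<forall>v w. \<phi> (v @ w) = \<phi> v @ \<phi> w)"

definition primitive :: "(word \<Rightarrow> word) \<Rightarrow> bool" where
  "primitive \<phi> \<longleftrightarrow> (\<exists>n. \<forall>a. set ((\<phi> ^^ n) [a]) = {False, True})"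

definition uniform :: "(word \<Rightarrow> word) \<Rightarrow> bool" where
  "uniform \<phi> \<longleftrightarrow> length (\<phi> [False]) = length (\<phi> [True])"

text \<open>
  The action of a morphism on an infinite word \<open>u\<^sub>0 u\<^sub>1 u\<^sub>2 \<dots>\<close> is the concatenation
  \<open>\<phi>(u\<^sub>0) \<phi>(u\<^sub>1) \<phi>(u\<^sub>2) \<dots>\<close>. The function \<^const>\<open>flat\<close> computes it when no letter is erased;
  primitive morphisms erase no letter.
\<close>

definition stream_image :: "(word \<Rightarrow> word) \<Rightarrow> bool stream \<Rightarrow> bool stream" where
  "stream_image \<phi> u = flat (smap (\<lambda>a. \<phi> [a]) u)"

definition fixed_point :: "(word \<Rightarrow> word) \<Rightarrow> bool stream \<Rightarrow> bool" where
  "fixed_point \<phi> u \<longleftrightarrow> stream_image \<phi> u = u"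

definition eventually_periodic :: "bool stream \<Rightarrow> bool" where
  "eventually_periodic u \<longleftrightarrow> (\<exists>v w. w \<noteq> [] \<and> u = v @- cycle w)"

definition factors :: "bool stream \<Rightarrow> word set" where
  "factors u = {stake n (sdrop i u) | i n. True}"

definition A2_representation :: "(word \<Rightarrow> word) \<Rightarrow> word \<Rightarrow> nat \<Rightarrow> nat \<Rightarrow> bool" where
  "A2_representation \<psi> w k h \<longleftrightarrow>
     w \<noteq> [] \<and>
     \<psi> [False] = thue_morse (w @ word_power (rev w @ w) k) \<and>
     \<psi> [True] = thue_morse (word_power (rev w @ w) h @ rev w)"

definition class_A2 :: "(word \<Rightarrow> word) set" where
  "class_A2 = {\<psi>. morphism \<psi> \<and> (\<exists>w k h. A2_representation \<psi> w k h)}"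

end

theory Submission
  imports Defs
begin

text \<open>
  The set of factors of \<open>u\<close> is uniformly recurrent, hence closed under reversal and under the letter
  complement. It has finitely many infinite left special words, and \<open>\<phi>\<close> acts on them by an
  injection \<open>w \<mapsto> z\<phi>(w)\<close> with a fixed word \<open>z\<close>. Complement invariance forces \<open>z\<close> to be empty, so the
  left special words are fixed points of powers of \<open>\<phi>\<close> and there are exactly two of them, \<open>U\<close> and its
  complement. Let \<open>\<sigma>\<close> be the conjugate of \<open>\<phi>\<close> by the complement. Then \<open>\<phi>(U) = \<sigma>(U)\<close>, and comparing
  \<open>\<phi>\<close> with its mirror image on \<open>U\<close> shows that \<open>\<phi>(0)\<close> and \<open>\<phi>(1)\<close> are both palindromes or both
  antipalindromes. As their lengths differ, combinatorics on words gives \<open>\<phi>(01) = \<sigma>(01)\<close> and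
  \<open>U = \<Theta>(v)\<close> for some \<open>v\<close>. The first identity makes \<open>\<phi>(0)\<close> and \<open>\<phi>(1)\<close> alternating products of a
  word \<open>x\<close> and its complement, and \<open>x\<close> is of even length, so \<open>x = \<Theta>(w)\<close>. If \<open>x\<close> is a palindrome, then
  \<open>w\<close> is an antipalindrome; if \<open>x\<close> is an antipalindrome, then \<open>\<phi>(x)\<close> is a palindrome that plays the
  role of \<open>x\<close> for \<open>\<phi>\<^sup>2\<close>.
\<close>

section \<open>Letterwise complement and comparison of prefixes\<close>

definition compl :: "word \<Rightarrow> word" where
  "compl w = map Not w"

lemma compl_Nil [simp]: "compl [] = []"
  and compl_Cons [simp]: "compl (a # v) = (\<not> a) # compl v"
  and compl_append [simp]: "compl (v @ w) = compl v @ compl w"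
  and length_compl [simp]: "length (compl w) = length w"
  by (simp_all add: compl_def)

lemma compl_compl [simp]: "compl (compl w) = w"
  by (induction w) auto

lemma compl_eq_Nil_iff [simp]: "compl w = [] \<longleftrightarrow> w = []"
  by (simp add: compl_def)

lemma compl_eq_self_iff [simp]: "compl w = w \<longleftrightarrow> w = []" "w = compl w \<longleftrightarrow> w = []"
  by (cases w; auto)+

lemma compl_replicate: "compl (replicate n a) = replicate n (\<not> a)"
  by (induction n) auto

lemma compl_rev: "compl (rev w) = rev (compl w)"
  by (simp add: compl_def rev_map)

lemma exchange_rev_conv: "exchange_rev w = rev (compl w)"
  by (simp add: exchange_rev_def compl_def)

lemma word_power_0 [simp]: "word_power w 0 = []"
  and word_power_Suc [simp]: "word_power w (Suc n) = w @ word_power w n"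
  by (simp_all add: word_power_def)

lemma word_power_comm: "word_power w n @ w = w @ word_power w n"
  by (induction n) auto

lemma word_power_commute: "v @ w = w @ v \<Longrightarrow> v @ word_power w n = word_power w n @ v"
proof (induction n)
  case (Suc n)
  then show ?case by (metis append_assoc word_power_Suc)
qed simp

lemma length_word_power [simp]: "length (word_power w n) = n * length w"
  by (induction n) auto

lemma compl_word_power [simp]: "compl (word_power w n) = word_power (compl w) n"
  by (induction n) auto

lemma shift_eq_shiftD:
  assumes "xs @- s = ys @- t" "length xs \<le> length ys"
  obtains zs where "ys = xs @ zs" "s = zs @- t"
proof -
  have "\<exists>zs. ys = xs @ zs \<and> s = zs @- t"
    using assms
  proof (induction xs arbitrary: ys)
    case (Cons x xs)
    then show ?case by (cases ys) auto
  qed simp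
  then show ?thesis using that by blast
qed

lemma shift_eq_shift_iff:
  "length xs = length ys \<Longrightarrow> xs @- s = ys @- t \<longleftrightarrow> xs = ys \<and> s = t"
  by (metis append_Nil2 append_eq_append_conv order_refl shift_eq_shiftD shift_left_inj)

lemma append_eq_appendD:
  assumes "xs @ s = ys @ t" "length xs \<le> length ys"
  obtains zs where "ys = xs @ zs" "s = zs @ t"
  using assms by (metis append_eq_append_conv_if append_eq_conv_conj append_take_drop_id)

subsection \<open>Alternating words\<close>

text \<open>If \<open>w\<close> is an antipalindrome, its mirror image is its complement. With
  \<open>x = thue_morse w\<close>, the two words defining class A_2 are then
  \<open>alternating (2 * k + 1) x\<close> and
  \<open>alternating (2 * h + 1) (compl x)\<close>.\<close>

primrec alternating :: "nat \<Rightarrow> word \<Rightarrow> word" where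
  "alternating 0 x = []"
| "alternating (Suc n) x = x @ alternating n (compl x)"

lemma alternating_add:
  "alternating (m + n) x = alternating m x @ alternating n (if even m then x else compl x)"
  by (induction m arbitrary: x) auto

lemma compl_alternating [simp]: "compl (alternating n x) = alternating n (compl x)"
  by (induction n arbitrary: x) auto

lemma length_alternating [simp]: "length (alternating n x) = n * length x"
  by (induction n arbitrary: x) auto

lemma alternating_even: "alternating (2 * n) x = word_power (x @ compl x) n"
  by (induction n) auto

lemma alternating_odd:
  "alternating (2 * n + 1) x = x @ word_power (compl x @ x) n"
  using alternating_even[of n "compl x"] by simp

lemma alternating_odd':
  "alternating (2 * n + 1) x = word_power (x @ compl x) n @ x"
proof -
  have "x @ word_power (compl x @ x) n = word_power (x @ compl x) n @ x"
    by (induction n) auto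
  then show ?thesis using alternating_odd by simp
qed

text \<open>A conjugacy equation twisted by the complement, solved by Euclidean descent: cancelling
  common prefixes leads to the same equation for shorter words or ends with
  \<open>c = b @ compl b\<close>.\<close>

lemma conjugate_compl_alternating:
  assumes "c @ b = b @ compl c" "c \<noteq> []"
  shows "\<exists>y h j. y \<noteq> [] \<and> b = alternating (2 * h + 1) y \<and> c = alternating (2 * j) y"
  using assms
proof (induction "length b + length c" arbitrary: b c rule: less_induct)
  case less
  have "b \<noteq> []" using less.prems by auto
  show ?case
  proof (cases "length c \<le> length b")
    case True
    then obtain f where f: "b = c @ f" "b = f @ compl c"
      using append_eq_appendD[OF less.prems(1)] by metis
    have "c @ f = f @ compl c" using f by simp
    moreover have "length f + length c < length b + length c"
      using f(1) less.prems(2) by simp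
    ultimately obtain y h j where "y \<noteq> []" "f = alternating (2 * h + 1) y" "c = alternating (2 * j) y"
      using less.hyps less.prems(2) by blast
    moreover from this have "b = alternating (2 * j + (2 * h + 1)) y"
      unfolding alternating_add[of "2 * j"] using f by (simp del: alternating.simps)
    then have "b = alternating (2 * (j + h) + 1) y"
      by (simp add: algebra_simps del: alternating.simps)
    ultimately show ?thesis by blast
  next
    case False
    then obtain d where d: "c = b @ d"
      using append_eq_appendD[OF less.prems(1)[symmetric]] by (metis nat_le_linear)
    \<comment> \<open>Here both factors are complemented; one more cancellation restores the
      original form.\<close>
    then have e: "d @ b = compl b @ compl d"
      using less.prems by simp
    have "d \<noteq> []" using e \<open>b \<noteq> []\<close> by auto
    consider "length d = length b" | "length b < length d" | "length d < length b"
      by linarith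
    then show ?thesis
    proof cases
      case 1
      then have "d = compl b" using e by (metis append_eq_append_conv length_compl)
      then have "b = alternating (2 * 0 + 1) b \<and> c = alternating (2 * 1) b"
        using d by (simp add: numeral_2_eq_2)
      then show ?thesis using \<open>b \<noteq> []\<close> by metis
    next
      case 2
      then obtain g where g: "d = compl b @ g" "compl d = g @ b"
        using append_eq_appendD[OF e[symmetric]] by (metis length_compl nat_less_le)
      then have "g \<noteq> []" using 2 by auto
      moreover have "g @ b = b @ compl g" using g by simp
      moreover have "length b + length g < length b + length c"
        using d g \<open>b \<noteq> []\<close> by simp
      ultimately obtain y h j where *: "y \<noteq> []" "b = alternating (2 * h + 1) y" "g = alternating (2 * j) y"
        using less.hyps by blast
      have "c = b @ compl b @ g" using d g by simp
      also have "\<dots> = alternating (2 * h + 1 + (2 * h + 1) + 2 * j) y"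
        unfolding alternating_add[of "2 * h + 1 + (2 * h + 1)"] alternating_add[of "2 * h + 1" "2 * h + 1"]
        using * by (simp del: alternating.simps)
      also have "\<dots> = alternating (2 * (2 * h + j + 1)) y"
        by (simp add: algebra_simps del: alternating.simps)
      finally show ?thesis using * by blast
    next
      case 3
      then obtain g where g: "compl b = d @ g" "b = g @ compl d"
        using append_eq_appendD[OF e] by (metis length_compl nat_less_le)
      have b: "b = compl d @ compl g" using g(1) by (metis compl_append compl_compl)
      then have "g \<noteq> []" using 3 by auto
      moreover have "g @ compl d = compl d @ compl g" using g b by simp
      moreover have "length (compl d) + length g < length b + length c"
        using b d \<open>d \<noteq> []\<close> by simp
      ultimately obtain y h j where *: "y \<noteq> []" "compl d = alternating (2 * h + 1) y" "g = alternating (2 * j) y"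
        using less.hyps by blast
      have b': "b = alternating (2 * (h + j) + 1) y"
      proof -
        have "b = alternating (2 * h + 1 + 2 * j) y"
          unfolding alternating_add[of "2 * h + 1"] using b * by (simp del: alternating.simps)
        then show ?thesis by (simp add: algebra_simps del: alternating.simps)
      qed
      have "d = alternating (2 * h + 1) (compl y)"
        using *(2) by (metis compl_alternating compl_compl)
      then have "c = alternating (2 * (h + j) + 1 + (2 * h + 1)) y"
        unfolding alternating_add[of "2 * (h + j) + 1"] using d b' by (simp del: alternating.simps)
      also have "\<dots> = alternating (2 * (2 * h + j + 1)) y"
        by (simp add: algebra_simps del: alternating.simps)
      finally show ?thesis using * b' by blast
    qed
  qed
qed

text \<open>If \<open>b\<close> is shorter, \<open>a = compl b @ c\<close> and cancelling gives
  \<open>c @ b = b @ compl c\<close>, solved above. If \<open>a\<close> is shorter, the equation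
  keeps its form for \<open>compl b\<close> and \<open>compl a\<close>, now with the longer word
  first.\<close>

lemma append_eq_compl_append_alternating:
  assumes "a @ b = compl b @ compl a" "a \<noteq> []"
  shows "\<exists>x k h. x \<noteq> [] \<and> a = alternating (2 * k + 1) x \<and> b = alternating (2 * h + 1) (compl x)"
proof -
  have *: "\<exists>x k h. x \<noteq> [] \<and> a = alternating (2 * k + 1) x \<and> b = alternating (2 * h + 1) (compl x)"
    if eq: "a @ b = compl b @ compl a" and lt: "length b < length a" for a b
  proof -
    obtain c where c: "a = compl b @ c" "compl a = c @ b"
      using append_eq_appendD[OF eq[symmetric]] lt by (metis length_compl nat_less_le)
    then have "c \<noteq> []" "c @ b = b @ compl c" using lt by auto
    then obtain y h j where *: "y \<noteq> []" "b = alternating (2 * h + 1) y" "c = alternating (2 * j) y"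
      using conjugate_compl_alternating by blast
    have "a = alternating (2 * h + 1 + 2 * j) (compl y)"
      unfolding alternating_add[of "2 * h + 1"] using c * by (simp del: alternating.simps)
    then have "a = alternating (2 * (h + j) + 1) (compl y)"
      by (simp add: algebra_simps del: alternating.simps)
    moreover have "compl y \<noteq> []" "b = alternating (2 * h + 1) (compl (compl y))"
      using * by (simp_all del: alternating.simps)
    ultimately show ?thesis by blast
  qed
  consider "length b = length a" | "length b < length a" | "length a < length b"
    by linarith
  then show ?thesis
  proof cases
    case 1
    then have "a = compl b" using assms(1) by (metis append_eq_append_conv length_compl)
    then have "a = alternating (2 * 0 + 1) a \<and> b = alternating (2 * 0 + 1) (compl a)" by simp
    then show ?thesis using assms(2) by blast
  next
    case 2
    then show ?thesis using *[OF assms(1)] by blast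
  next
    case 3
    then obtain x k h where "x \<noteq> []" "compl b = alternating (2 * k + 1) x"
      "compl a = alternating (2 * h + 1) (compl x)"
      using *[of "compl b" "compl a"] assms by auto
    then have "b = alternating (2 * k + 1) (compl x)" "a = alternating (2 * h + 1) x"
      by (metis compl_alternating compl_compl)+
    then show ?thesis using \<open>x \<noteq> []\<close> by blast
  qed
qed

subsection \<open>Equations between images of letters\<close>

text \<open>Both R and E are instances, so palindromic and antipalindromic images are treated by one
  argument.\<close>

locale word_reversal =
  fixes J :: "word \<Rightarrow> word"
  assumes J_append [simp]: "J (v @ w) = J w @ J v"
    and J_J [simp]: "J (J w) = w"
    and J_compl [simp]: "J (compl w) = compl (J w)"
    and length_J [simp]: "length (J w) = length w"
begin

lemma J_Nil [simp]: "J [] = []"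
  using length_J[of "[]"] by (simp del: length_J)

lemma J_word_power: "J (word_power w n) = word_power (J w) n"
  by (induction n) (auto simp: word_power_comm)

text \<open>
  If \<open>c\<close> commutes with \<open>q\<close>, both begin with the same letter, which is not the first letter of
  the complement of \<open>q @ c\<close>.
\<close>

lemma commuting_image_contradiction:
  assumes eq: "word_power (q @ c) n @- s = word_power q n @- compl (q @ c) @- t"
    and comm: "c @ q = q @ c" and "c \<noteq> []" "q \<noteq> []" "n > 0"
  shows False
proof -
  have "word_power (q @ c) n = word_power q n @ word_power c n"
  proof (induction n)
    case (Suc n)
    have "c @ word_power q n = word_power q n @ c" using comm by (rule word_power_commute)
    then show ?case using Suc by (metis append_assoc word_power_Suc)
  qed simp
  then have "word_power c n @- s = compl (q @ c) @- t"
    using eq by simp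
  then have "hd c = hd (compl q)"
    using \<open>n > 0\<close> \<open>c \<noteq> []\<close> \<open>q \<noteq> []\<close> by (cases n; cases c; cases q) auto
  moreover have "hd c = hd q"
    using comm \<open>c \<noteq> []\<close> \<open>q \<noteq> []\<close> by (cases c; cases q) auto
  ultimately show False using \<open>q \<noteq> []\<close> by (cases q) auto
qed

text \<open>
  This is applied to \<open>a = \<phi>(0)\<close> and \<open>q = compl \<phi>(1)\<close>: no infinite word beginning with \<open>0\<^sup>n1\<close>, \<open>n \<ge> 2\<close>,
  has equal images under \<open>\<phi>\<close> and its conjugate by the complement. If \<open>a\<close> and \<open>q\<close> do not commute,
  then \<open>a = q p q\<close> with \<open>J p = p\<close>, and one compares the positions of \<open>p\<close> and \<open>q\<close> according to the
  largest power of \<open>q\<close> that is a prefix of \<open>p\<close>.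
\<close>

lemma square_images_contradiction:
  assumes a: "J a = a" and q: "J q = q" "q \<noteq> []" and len: "length q < length a" and n: "n \<ge> 2"
    and eq: "word_power a n @- S = word_power q n @- compl a @- T"
  shows False
proof -
  obtain m where m: "n = Suc m" "m \<ge> 1" using n by (cases n) auto
  obtain m' where m': "m = Suc m'" using m by (cases m) auto
  obtain c where c: "a = q @ c"
    using eq m len by (auto elim!: shift_eq_shiftD[OF sym])
  have Jc: "a = J c @ q" using a c q by simp
  have "c \<noteq> []" using c len by auto
  have not_comm: "c @ q \<noteq> q @ c"
    using commuting_image_contradiction[of q c n] eq c \<open>c \<noteq> []\<close> q n by auto
  have eq2: "c @- a @- word_power a m' @- S = word_power q m @- compl a @- T"
    using eq m m' c by simp
  \<comment> \<open>Otherwise \<open>c\<close> and \<open>J c\<close> are both prefixes of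
    \<open>q\<close>, hence equal, and \<open>q @ c = J c @ q\<close> makes \<open>c\<close> and
    \<open>q\<close> commute.\<close>
  have "length c > length q"
  proof (rule ccontr)
    assume "\<not> length c > length q"
    then have le: "length c \<le> length q" by simp
    then obtain r where "q = c @ r"
      using eq2 m' by (auto elim!: shift_eq_shiftD)
    moreover obtain r' where "q = J c @ r'"
      using append_eq_appendD[of "J c" q q c] le Jc c by auto
    ultimately have "J c = c" by (metis append_eq_append_conv length_J)
    then show False using c Jc not_comm by simp
  qed
  then obtain p where p: "c = p @ q"
    using append_eq_appendD[of q c "J c" q] c Jc
    by (metis append_eq_append_conv_if append_take_drop_id length_J nat_less_le)
  have a_qpq: "a = q @ p @ q" using c p by simp
  have Jp: "J p = p" using a a_qpq q by simp
  have comm: "p @ q \<noteq> q @ p" using not_comm p by (metis append_assoc)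
  define S' where "S' = word_power a m' @- S"
  have eq3: "p @- q @- q @- p @- q @- S' = word_power q m @- compl q @- compl p @- compl q @- T"
    using eq2 p a_qpq by (simp add: S'_def)
  let ?P = "\<lambda>j. j \<le> m \<and> (\<exists>s. p = word_power q j @ s)"
  have "?P 0" by simp
  then obtain j where j: "?P j" and max: "\<And>i. ?P i \<Longrightarrow> i \<le> j"
    using GreatestI_nat[of ?P 0 m] Greatest_le_nat[of ?P _ m] by blast
  then obtain s where s: "p = word_power q j @ s" by blast
  have s': "p = J s @ word_power q j" using Jp s q J_word_power by simp
  show False
  proof (cases "j < m")
    \<comment> \<open>After cancelling \<open>word_power q j\<close>, the rest \<open>s\<close> of
      \<open>p\<close> faces another \<open>q\<close>. Maximality of \<open>j\<close> makes
      \<open>s\<close> shorter than \<open>q\<close>, so \<open>q = s @ t\<close>; each subcase then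
      makes \<open>s\<close> commute with \<open>q\<close>, hence \<open>p\<close> with
      \<open>q\<close>.\<close>
    case True
    then obtain i where i: "m = j + Suc i" by (metis less_imp_Suc_add add_Suc_right)
    have wp: "word_power q m = word_power q j @ word_power q (Suc i)"
      unfolding i by (induction j) auto
    have eq4: "s @- q @- q @- p @- q @- S' = q @- word_power q i @- compl q @- compl p @- compl q @- T"
      using eq3 unfolding wp by (subst (asm) (1) s) simp
    have short: "length s < length q"
    proof (rule ccontr)
      assume "\<not> length s < length q"
      then obtain r where "s = q @ r"
        using eq4 by (auto elim!: shift_eq_shiftD[OF sym])
      then have "p = word_power q (Suc j) @ r"
        using s word_power_comm by (metis append_assoc word_power_Suc)
      then have "?P (Suc j)" using True by auto
      then show False using max by force
    qed
    then obtain t where t: "q = s @ t"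
      "q @- q @- p @- q @- S' = t @- word_power q i @- compl q @- compl p @- compl q @- T"
      using shift_eq_shiftD[OF eq4] by auto
    have comm_s: "s @ q \<noteq> q @ s"
    proof
      assume "s @ q = q @ s"
      then have "s @ word_power q j = word_power q j @ s"
        by (rule word_power_commute)
      then have "p @ q = q @ p"
        using s \<open>s @ q = q @ s\<close> word_power_comm by (metis append_assoc)
      then show False using comm by simp
    qed
    show False
    proof (cases j)
      case 0
      then have ps: "p = s" using s by simp
      have tp: "q = J t @ p" using q t Jp ps by (metis J_append)
      show False
      proof (cases i)
        case 0
        have "length t \<le> length q" using t(1) by simp
        then obtain r where "q = t @ r"
          using t(2) 0 shift_eq_shiftD[OF sym] by (metis shift.simps(1) word_power_0)
        then have "J t = t" using tp by (metis append_eq_append_conv length_J)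
        then show False using comm t tp ps by (metis append_assoc)
      next
        case (Suc i')
        define X where "X = q @- p @- q @- S'"
        define Y where "Y = word_power q i' @- compl q @- compl p @- compl q @- T"
        have "q @- X = t @- q @- Y" using t(2) Suc by (simp add: X_def Y_def)
        then have "(s @ t) @- X = (t @ s) @- t @- Y" using t(1) by (metis append_assoc shift_append)
        then have "s @ t = t @ s"
          by (subst (asm) shift_eq_shift_iff) auto
        then show False using comm_s t(1) by (metis append_assoc)
      qed
    next
      case (Suc j')
      have eq5: "word_power q j @ s = J s @ word_power q j" using s s' by simp
      then obtain r where "q = J s @ r"
        using append_eq_appendD[of "J s" "word_power q j" q "word_power q j' @ s"] short Suc
        by auto
      then have Js: "J s = s" using t(1) by (metis append_eq_append_conv length_J)
      have "\<exists>z. word_power q j' @ s = s @ z"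
        using t(1) by (cases j') auto
      then obtain z where "word_power q j' @ s = s @ z" by blast
      then have "q @ s @ z = s @ q @ word_power q j'"
        using eq5 Suc Js by simp
      then have "q @ s = s @ q"
        by (metis (no_types, opaque_lifting) append_assoc append_eq_append_conv add.commute length_append)
      then show False using comm_s by simp
    qed
  next
    case False
    then have "j = m" using j by simp
    have eq4: "s @- q @- q @- p @- q @- S' = compl q @- compl p @- compl q @- T"
      using eq3 unfolding \<open>j = m\<close>[symmetric] by (subst (asm) (1) s) simp
    have eq5: "q @ word_power q m' @ s = J s @ q @ word_power q m'"
      using s s' \<open>j = m\<close> m' by simp
    show False
    proof (cases "length s < length q")
      \<comment> \<open>Here \<open>s\<close> faces \<open>compl q = s @ t0\<close>. Comparing
        prefixes of \<open>q\<close> gives \<open>t0 = compl t0\<close>, so \<open>t0\<close> is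
        empty, although \<open>s\<close> is shorter than \<open>q\<close>.\<close>
      case True
      then obtain t0 where t0: "compl q = s @ t0" "q @- q @- p @- q @- S' = t0 @- compl p @- compl q @- T"
        using shift_eq_shiftD[OF eq4] by auto
      define t where "t = compl t0"
      have q_st: "q = compl s @ t" using t0(1) unfolding t_def by (metis compl_append compl_compl)
      obtain r where "q = J s @ r"
        using append_eq_appendD[OF eq5[symmetric]] True by auto
      then have Js: "J s = compl s" using q_st by (metis append_eq_append_conv length_J length_compl)
      have "length t0 \<le> length q" using t0(1) by (metis length_append length_compl le_add2)
      then obtain r' where r': "q = t0 @ r'" using t0(2) by (auto elim!: shift_eq_shiftD[OF sym])
      have "word_power q m' @ q = t @ word_power q m' @ s"
      proof -
        have "compl s @ t @ word_power q m' @ s = compl s @ q @ word_power q m'"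
          using eq5 Js q_st by (metis append_assoc)
        then show ?thesis by (simp add: word_power_comm)
      qed
      then have "q @ word_power q m' = t @ word_power q m' @ s" by (simp add: word_power_comm)
      then have "t0 @ r' @ word_power q m' = t @ word_power q m' @ s" using r' by simp
      then have "t0 = t" unfolding t_def by (metis append_eq_append_conv length_compl)
      then have "t = []" unfolding t_def by simp
      then show False using True q_st by simp
    next
      \<comment> \<open>Counting lengths places \<open>q\<close> at the end of
        \<open>compl p\<close>, so \<open>p\<close> ends in \<open>compl q\<close>; by
        \<open>s'\<close> it also ends in \<open>q\<close>.\<close>
      case False
      then obtain s1 where s1: "s = compl q @ s1"
        using eq4 by (auto elim!: shift_eq_shiftD[OF sym])
      have cp: "compl p = word_power (compl q) m @ q @ compl s1"
        using s \<open>j = m\<close> s1 by simp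
      have "s1 @- q @- q @- p @- q @- S' = compl p @- compl q @- T"
        using eq4 s1 by simp
      moreover have "word_power q m @- q @- Z = q @- word_power q m @- Z" for Z
        by (metis shift_append word_power_comm)
      then have "q @- q @- p @- q @- S' = word_power q (Suc m) @- q @- s @- q @- S'"
        using s \<open>j = m\<close> by simp
      ultimately have "(s1 @ word_power q (Suc m)) @- q @- s @- q @- S' = compl p @- compl q @- T"
        by simp
      moreover have "length (s1 @ word_power q (Suc m)) = length (compl p)"
        using cp by simp
      ultimately have "compl p = s1 @ word_power q (Suc m)"
        using shift_eq_shift_iff by metis
      then have "p = compl s1 @ word_power (compl q) m @ compl q"
        by (metis compl_append compl_compl compl_word_power word_power_Suc word_power_comm)
      moreover have "p = J s @ word_power q m' @ q"
        using s' \<open>j = m\<close> m' by (simp add: word_power_comm)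
      ultimately have "(compl s1 @ word_power (compl q) m) @ compl q = (J s @ word_power q m') @ q"
        by simp
      then have "compl q = q"
        by (subst (asm) append_eq_append_conv) auto
      then show False using q by simp
    qed
  qed
qed

end

lemma word_reversal_rev: "word_reversal rev"
  by unfold_locales (auto simp: compl_rev)

lemma word_reversal_exchange_rev: "word_reversal exchange_rev"
  by unfold_locales (auto simp: exchange_rev_conv compl_rev)

subsection \<open>Morphisms on finite and infinite words\<close>

definition scompl :: "bool stream \<Rightarrow> bool stream" where
  "scompl w = smap Not w"

lemma scompl_Stream [simp]: "scompl (a ## s) = (\<not> a) ## scompl s"
  and scompl_shift [simp]: "scompl (v @- s) = compl v @- scompl s"
  and stake_scompl [simp]: "stake n (scompl s) = compl (stake n s)"
  and shd_scompl [simp]: "shd (scompl s) \<longleftrightarrow> \<not> shd s"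
  and snth_scompl [simp]: "scompl s !! n \<longleftrightarrow> \<not> s !! n"
  by (simp_all add: scompl_def compl_def)

lemma stream_eqI:
  assumes "\<And>n. w !! n = w' !! n"
  shows "w = w'"
  using assms smap_alt[of id w w'] by (simp add: stream.map_id)

lemma scompl_scompl [simp]: "scompl (scompl s) = s"
  by (rule stream_eqI) simp

text \<open>Stands in for coinduction: images of infinite words are compared through images of ever
  longer prefixes.\<close>

lemma stream_eqI_prefix:
  assumes "\<And>n. \<exists>v s s'. n \<le> length v \<and> w = v @- s \<and> w' = v @- s'"
  shows "w = w'"
proof (rule stream_eqI)
  fix n
  obtain v s s' where "Suc n \<le> length v" "w = v @- s" "w' = v @- s'"
    using assms by meson
  then show "w !! n = w' !! n" by simp
qed

locale nonerasing_morphism =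
  fixes f :: "word \<Rightarrow> word"
  assumes morphism: "morphism f" and nonerasing: "f [a] \<noteq> []"
begin

lemma image_append [simp]: "f (v @ w) = f v @ f w"
  using morphism by (simp add: morphism_def)

lemma image_Nil [simp]: "f [] = []"
  using image_append[of "[]" "[]"] by (simp del: image_append)

lemma image_Cons: "f (a # v) = f [a] @ f v"
  using image_append[of "[a]" v] by (simp del: image_append)

lemma length_image_ge: "length v \<le> length (f v)"
proof (induction v)
  case (Cons a v)
  have "length (f [a]) > 0" using nonerasing by simp
  then show ?case using Cons image_Cons[of a v] by (simp del: length_greater_0_conv)
qed simp

lemma image_word_power: "f (word_power v n) = word_power (f v) n"
  by (induction n) auto

lemma stream_image_Stream: "stream_image f (a ## s) = f [a] @- stream_image f s"
  using nonerasing by (simp add: stream_image_def)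

lemma stream_image_shd: "stream_image f s = f [shd s] @- stream_image f (stl s)"
  using stream_image_Stream[of "shd s" "stl s"] by simp

lemma stream_image_shift [simp]: "stream_image f (v @- s) = f v @- stream_image f s"
proof (induction v)
  case (Cons a v)
  then show ?case using image_Cons[of a v] by (simp add: stream_image_Stream)
qed simp

lemma stream_image_stake: "stream_image f s = f (stake n s) @- stream_image f (sdrop n s)"
  using stream_image_shift[of "stake n s" "sdrop n s"] by (simp add: stake_sdrop)

lemma funpow_morphism: "nonerasing_morphism (f ^^ n)"
proof (unfold_locales)
  show "morphism (f ^^ n)"
    unfolding morphism_def by (induction n) auto
  fix a
  have "length v \<le> length ((f ^^ n) v)" for v
    by (induction n) (auto intro: order_trans length_image_ge)
  from this[of "[a]"] show "(f ^^ n) [a] \<noteq> []" by auto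
qed

lemma stream_image_funpow: "stream_image (f ^^ n) s = (stream_image f ^^ n) s"
proof (induction n)
  case 0
  interpret i: nonerasing_morphism "f ^^ 0" by (rule funpow_morphism)
  show ?case
    by (rule stream_eqI_prefix)
      (metis i.stream_image_stake stake_sdrop funpow_0 length_stake order_refl)
next
  case (Suc n)
  interpret i: nonerasing_morphism "f ^^ n" by (rule funpow_morphism)
  interpret s: nonerasing_morphism "f ^^ Suc n" by (rule funpow_morphism)
  have "stream_image (f ^^ Suc n) s = stream_image f (stream_image (f ^^ n) s)"
  proof (rule stream_eqI_prefix)
    fix m
    have "stream_image (f ^^ Suc n) s = (f ^^ Suc n) (stake m s) @- stream_image (f ^^ Suc n) (sdrop m s)"
      by (rule s.stream_image_stake)
    moreover have "stream_image f (stream_image (f ^^ n) s)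
      = (f ^^ Suc n) (stake m s) @- stream_image f (stream_image (f ^^ n) (sdrop m s))"
      by (subst i.stream_image_stake[of s m]) simp
    moreover have "m \<le> length ((f ^^ Suc n) (stake m s))"
      using s.length_image_ge[of "stake m s"] by simp
    ultimately show "\<exists>v t t'. m \<le> length v \<and> stream_image (f ^^ Suc n) s = v @- t
        \<and> stream_image f (stream_image (f ^^ n) s) = v @- t'"
      by blast
  qed
  then show ?case by (simp only: funpow.simps(2)[of n "stream_image f"] comp_apply Suc)
qed

lemma compl_morphism: "nonerasing_morphism (\<lambda>v. compl (f (compl v)))"
  by unfold_locales (auto simp: morphism_def nonerasing)

lemma rev_morphism: "nonerasing_morphism (\<lambda>v. rev (f (rev v)))"
  by unfold_locales (auto simp: morphism_def nonerasing)

lemma scompl_stream_image: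
  "scompl (stream_image f s) = stream_image (\<lambda>v. compl (f (compl v))) (scompl s)"
proof (rule stream_eqI_prefix)
  fix m
  interpret c: nonerasing_morphism "\<lambda>v. compl (f (compl v))" by (rule compl_morphism)
  let ?v = "compl (f (stake m s))"
  have "scompl (stream_image f s) = ?v @- scompl (stream_image f (sdrop m s))"
    by (subst stream_image_stake[of s m]) simp
  moreover have "stream_image (\<lambda>v. compl (f (compl v))) (scompl s)
    = ?v @- stream_image (\<lambda>v. compl (f (compl v))) (sdrop m (scompl s))"
    by (subst c.stream_image_stake[of "scompl s" m]) simp
  moreover have "m \<le> length ?v"
    using length_image_ge[of "stake m s"] by simp
  ultimately show "\<exists>v t t'. m \<le> length v \<and> scompl (stream_image f s) = v @- t
      \<and> stream_image (\<lambda>v. compl (f (compl v))) (scompl s) = v @- t'"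
    by blast
qed

end

text \<open>\<open>z\<close> is the longest common prefix of \<open>a @ b\<close> and
  \<open>b @ a\<close>. The word \<open>a @ b @ a\<close> begins with both \<open>z @ [c]\<close>
  and \<open>a @ z\<close>, and the latter is long enough to contain the former; similarly for
  \<open>b @ a @ b\<close>.\<close>

lemma binary_code_delay:
  fixes a b :: word
  assumes "a @ b \<noteq> b @ a"
  obtains z c y y' where "a @ z = z @ c # y" "b @ z = z @ (\<not> c) # y'"
proof -
  obtain z c d r r' where *: "c \<noteq> d" "a @ b = z @ [c] @ r" "b @ a = z @ [d] @ r'"
    using same_length_different[OF assms] by auto
  have ne: "a \<noteq> []" "b \<noteq> []" using assms by auto
  have "(z @ [c]) @ (r @ a) = (a @ z) @ ([d] @ r')"
    using * by (metis append_assoc)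
  moreover have "length (z @ [c]) \<le> length (a @ z)" using ne by (cases a) auto
  ultimately obtain y where y: "a @ z = (z @ [c]) @ y"
    by (rule append_eq_appendD)
  have "(z @ [d]) @ (r' @ b) = (b @ z) @ ([c] @ r)"
    using * by (metis append_assoc)
  moreover have "length (z @ [d]) \<le> length (b @ z)" using ne by (cases b) auto
  ultimately obtain y' where y': "b @ z = (z @ [d]) @ y'"
    by (rule append_eq_appendD)
  have "d = (\<not> c)" using * by auto
  then show ?thesis using that[of z c y y'] y y' by simp
qed

locale binary_code = nonerasing_morphism +
  assumes not_commute: "f [False] @ f [True] \<noteq> f [True] @ f [False]"
begin

text \<open>The letter \<open>a = c\<close> is \<open>a\<close> or its complement, with the same
  choice for all \<open>a\<close>. So the letter after \<open>z\<close> decodes the first letter of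
  the preimage, whence \<open>inj_stream_image\<close>.\<close>

lemma prefix_delay:
  obtains z c where "\<And>a s. \<exists>t. stream_image f (a ## s) = z @- (a = c) ## t"
proof -
  obtain z c y y' where zc: "f [False] @ z = z @ c # y" "f [True] @ z = z @ (\<not> c) # y'"
    using binary_code_delay[OF not_commute] by blast
  have pre: "\<exists>x. f v @ z = z @ x" for v
  proof (induction v)
    case (Cons a v)
    then obtain x where "f v @ z = z @ x" by blast
    then have "f (a # v) @ z = (f [a] @ z) @ x" using image_Cons[of a v] by simp
    then show ?case using zc by (cases a) auto
  qed simp
  have spre: "\<exists>t. stream_image f s = z @- t" for s
  proof -
    let ?v = "f (stake (length z) s)"
    obtain x where "?v @ z = z @ x" using pre by blast
    moreover have "length z \<le> length ?v" using length_image_ge[of "stake (length z) s"] by simp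
    ultimately obtain x' where "?v = z @ x'" by (metis append_eq_appendD)
    then show ?thesis using stream_image_stake[of s "length z"] by auto
  qed
  have "\<exists>t. stream_image f (a ## s) = z @- (a = (\<not> c)) ## t" for a s
  proof -
    obtain t where "stream_image f s = z @- t" using spre by blast
    then have "stream_image f (a ## s) = (f [a] @ z) @- t" by (simp add: stream_image_Stream)
    then show ?thesis using zc by (cases a) auto
  qed
  then show ?thesis using that by blast
qed

lemma inj_stream_image: "inj (stream_image f)"
proof (rule injI, rule ccontr)
  obtain z c where zc: "\<And>a s. \<exists>t. stream_image f (a ## s) = z @- (a = c) ## t"
    using prefix_delay by blast
  fix s t assume eq: "stream_image f s = stream_image f t" and "s \<noteq> t"
  then obtain n where n: "s !! n \<noteq> t !! n" and least: "\<And>i. i < n \<Longrightarrow> s !! i = t !! i"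
    using exists_least_iff[of "\<lambda>n. s !! n \<noteq> t !! n"] stream_eqI by blast
  have "stake n s = stake n t" by (rule nth_equalityI) (use least in auto)
  then have "stream_image f (sdrop n s) = stream_image f (sdrop n t)"
    using eq stream_image_stake[of s n] stream_image_stake[of t n] by simp
  then have "stream_image f (s !! n ## sdrop (Suc n) s) = stream_image f (t !! n ## sdrop (Suc n) t)"
    by (metis sdrop_simps stream.collapse)
  moreover obtain r where "stream_image f (s !! n ## sdrop (Suc n) s) = z @- (s !! n = c) ## r"
    using zc by blast
  moreover obtain r' where "stream_image f (t !! n ## sdrop (Suc n) t) = z @- (t !! n = c) ## r'"
    using zc by blast
  ultimately show False using n by auto
qed

text \<open>The same decoding from the right, by \<open>binary_code_delay\<close> for the reversed
  images.\<close>

lemma suffix_delay: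
  obtains z c where "\<And>a. \<exists>y. z @ f [a] = y @ (a = c) # z"
proof -
  have "rev (f [False]) @ rev (f [True]) \<noteq> rev (f [True]) @ rev (f [False])"
    using not_commute by (metis rev_append rev_rev_ident)
  then obtain z c y y' where *: "rev (f [False]) @ z = z @ c # y" "rev (f [True]) @ z = z @ (\<not> c) # y'"
    using binary_code_delay by blast
  have 1: "rev z @ f [False] = rev y @ c # rev z"
    using arg_cong[OF *(1), of rev] by simp
  have 2: "rev z @ f [True] = rev y' @ (\<not> c) # rev z"
    using arg_cong[OF *(2), of rev] by simp
  have "\<exists>y. rev z @ f [a] = y @ (a = (\<not> c)) # rev z" for a
    using 1 2 by (cases a) auto
  then show ?thesis using that by blast
qed

end

subsection \<open>Left special infinite words\<close>

definition left_special :: "word set \<Rightarrow> bool stream set" where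
  "left_special L = {w. \<forall>n a. a # stake n w \<in> L}"

locale language =
  fixes L :: "word set"
  assumes factor_closed: "x @ v @ y \<in> L \<Longrightarrow> v \<in> L"
    and left_extendable: "v \<in> L \<Longrightarrow> \<exists>x. n \<le> length x \<and> x @ v \<in> L"
begin

text \<open>Both letters precede \<open>w\<close>, and \<open>suffix_delay\<close> turns them into
  two distinct letters in front of \<open>z @- stream_image f w\<close>.\<close>

lemma special_image:
  assumes "binary_code f" and closed: "\<And>v. v \<in> L \<Longrightarrow> f v \<in> L"
  shows "\<exists>z. \<forall>w \<in> left_special L. z @- stream_image f w \<in> left_special L"
proof -
  interpret binary_code f by fact
  obtain z c where zc: "\<And>a. \<exists>y. z @ f [a] = y @ (a = c) # z"
    using suffix_delay by blast
  have suf: "\<exists>y. z @ f v = y @ z" for v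
  proof (induction v rule: rev_induct)
    case (snoc a v)
    then obtain y where "z @ f v = y @ z" by blast
    moreover obtain y' where "z @ f [a] = y' @ (a = c) # z" using zc by blast
    ultimately have "z @ f (v @ [a]) = (y @ y' @ [a = c]) @ z" by (metis append_assoc append_Cons append_Nil image_append)
    then show ?case by blast
  qed simp
  have "z @- stream_image f w \<in> left_special L" if w: "w \<in> left_special L" for w
    unfolding left_special_def
  proof (intro CollectI allI)
    fix n a
    define b where "b = (a = c)"
    have "(b = c) = a" by (auto simp: b_def)
    then obtain y where y: "z @ f [b] = y @ a # z" using zc[of b] by auto
    have "b # stake n w \<in> L" using w by (simp add: left_special_def)
    \<comment> \<open>A left extension at least as long as \<open>z\<close> has an image that ends
      in \<open>z\<close>.\<close>
    then obtain x where x: "length z \<le> length x" "x @ b # stake n w \<in> L"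
      using left_extendable by blast
    then have in_L: "f x @ f [b] @ f (stake n w) \<in> L"
      using closed[OF x(2)] image_Cons[of b "stake n w"] by simp
    obtain x' where x': "f x = x' @ z"
    proof -
      obtain y where y: "z @ f x = y @ z" using suf by blast
      moreover have "length (z @ f x) = length (y @ z)" using y by simp
      then have "length z \<le> length y" using x length_image_ge[of x] by simp
      ultimately show ?thesis using that append_eq_appendD by blast
    qed
    have pre: "stake n (z @- stream_image f w) = take n (z @ f (stake n w))"
    proof -
      have "z @- stream_image f w = (z @ f (stake n w)) @- stream_image f (sdrop n w)"
        using stream_image_stake[of w n] by simp
      moreover have "n \<le> length (z @ f (stake n w))"
        using length_image_ge[of "stake n w"] by simp
      ultimately show ?thesis by (simp add: stake_shift)
    qed
    have "f x @ f [b] @ f (stake n w) = (x' @ y) @ (a # take n (z @ f (stake n w))) @ drop n (z @ f (stake n w))"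
      using x' y by (metis append_Cons append_assoc append_take_drop_id)
    then show "a # stake n (z @- stream_image f w) \<in> L"
      using in_L factor_closed unfolding pre by metis
  qed
  then show ?thesis by blast
qed

text \<open>
  An iterate of the injection \<open>w \<mapsto> z @- f w\<close> fixes both \<open>w\<close> and its complement, which
  therefore share a prefix containing \<open>z\<close>.
\<close>

lemma special_image_periodic:
  assumes "binary_code f" and closed: "\<And>v. v \<in> L \<Longrightarrow> f v \<in> L"
    and fin: "finite (left_special L)" and w: "w \<in> left_special L" "scompl w \<in> left_special L"
  shows "stream_image f w \<in> left_special L" "\<exists>r>0. (stream_image f ^^ r) w = w"
proof -
  interpret binary_code f by fact
  obtain z where z: "\<And>w. w \<in> left_special L \<Longrightarrow> z @- stream_image f w \<in> left_special L"
    using special_image[OF assms(1) closed] by blast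
  define g where "g = (\<lambda>w. z @- stream_image f w)"
  have inj: "inj g" using inj_stream_image by (auto simp: inj_def g_def)
  have per: "\<exists>n>0. (g ^^ n) v = v" if "v \<in> left_special L" for v
  proof -
    have "(g ^^ n) v \<in> left_special L" for n
      by (induction n) (use that z in \<open>auto simp: g_def\<close>)
    then have "finite {y. \<exists>n. y = (g ^^ n) v}"
      by (intro finite_subset[OF _ fin]) auto
    then show ?thesis using funpow_inj_finite[OF inj] by metis
  qed
  obtain n1 n2 where n: "n1 > 0" "(g ^^ n1) w = w" "n2 > 0" "(g ^^ n2) (scompl w) = scompl w"
    using per w by blast
  define r where "r = n1 * n2"
  have fix_mult: "(g ^^ (m * n)) v = v" if "(g ^^ n) v = v" for m n v
    by (induction m) (use that in \<open>auto simp: funpow_add\<close>)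
  have r: "r > 0" "(g ^^ r) w = w" "(g ^^ r) (scompl w) = scompl w"
    using n fix_mult[of n1 w n2] fix_mult[of n2 "scompl w" n1] by (auto simp: r_def mult.commute)
  \<comment> \<open>\<open>p n\<close> is the prefix that \<open>n\<close> applications of
    \<open>g\<close> put in front. \<open>p r\<close> is a prefix of \<open>w\<close> and of
    \<open>scompl w\<close>, so it equals its own complement and is empty.\<close>
  define p where "p n = ((\<lambda>x. z @ f x) ^^ n) []" for n
  have gp: "(g ^^ n) v = p n @- (stream_image f ^^ n) v" for n v
    by (induction n) (auto simp: g_def p_def)
  have "p r @- (stream_image f ^^ r) w = w" "p r @- (stream_image f ^^ r) (scompl w) = scompl w"
    using r gp by auto
  then have "stake (length (p r)) w = p r" "stake (length (p r)) (scompl w) = p r"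
    by (metis stake_shift take_all order_refl diff_self_eq_0 append_Nil2 stake.simps(1))+
  then have "p r = []" by (metis stake_scompl compl_eq_self_iff(1))
  then have "z = []" using r(1) by (cases r) (auto simp: p_def)
  then show "stream_image f w \<in> left_special L" "\<exists>r>0. (stream_image f ^^ r) w = w"
    using z[OF w(1)] r g_def by auto
qed

end

subsection \<open>Fixed points of primitive morphisms\<close>

lemma finite_words: "finite {v :: word. length v = n}"
  using finite_lists_length_eq[of "UNIV :: bool set" n] by simp

lemma eq_cycle_if_shift_eq:
  fixes w :: word
  assumes "s = w @- s" "w \<noteq> []"
  shows "s = cycle w"
proof (rule stream_eqI_prefix)
  fix n
  have *: "t = word_power w n @- t" if "t = w @- t" for t
  proof (induction n)
    case (Suc n)
    have "word_power w (Suc n) @- t = w @- word_power w n @- t" by simp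
    then show ?case using Suc that by metis
  qed simp
  have "s = word_power w n @- s" "cycle w = word_power w n @- cycle w"
    using * assms cycle_decomp[OF assms(2)] by blast+
  moreover have "n \<le> length (word_power w n)" using assms(2) by (cases w) auto
  ultimately show "\<exists>v t t'. n \<le> length v \<and> s = v @- t \<and> cycle w = v @- t'" by blast
qed

lemma factors_iff: "v \<in> factors u \<longleftrightarrow> (\<exists>x s. u = x @- v @- s)"
proof
  assume "v \<in> factors u"
  then obtain i n where "v = stake n (sdrop i u)" by (auto simp: factors_def)
  then have "u = stake i u @- v @- sdrop n (sdrop i u)" by (metis stake_sdrop)
  then show "\<exists>x s. u = x @- v @- s" by blast
next
  assume "\<exists>x s. u = x @- v @- s"
  then obtain x s where "u = x @- v @- s" by blast
  then have "v = stake (length v) (sdrop (length x) u)"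
    by (simp add: sdrop_shift stake_shift)
  then show "v \<in> factors u" by (auto simp: factors_def)
qed

lemma exists_long_word:
  assumes "infinite (W :: word set)"
  shows "\<exists>w \<in> W. n \<le> length w"
proof (rule ccontr)
  assume "\<not> ?thesis"
  then have "W \<subseteq> {w. set w \<subseteq> UNIV \<and> length w \<le> n}" by auto
  moreover have "finite {w :: word. set w \<subseteq> UNIV \<and> length w \<le> n}"
    by (rule finite_lists_length_le) simp
  ultimately show False using assms finite_subset by blast
qed

text \<open>
  Each infinite left special word contributes a left special factor of every length, hence at least
  one to each increment of the factor complexity, which grows at most linearly.
\<close>

lemma (in language) finite_left_special:
  assumes linear: "\<And>n. n > 0 \<Longrightarrow> card {v \<in> L. length v = n} \<le> C * n"
  shows "finite (left_special L)"
proof (rule ccontr)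
  assume "infinite (left_special L)"
  then obtain S where S: "S \<subseteq> left_special L" "finite S" "card S = Suc C"
    using infinite_arbitrarily_large by blast
  let ?L = "\<lambda>n. {v \<in> L. length v = n}"
  have "\<exists>n. \<forall>w\<in>S. \<forall>w'\<in>S. w \<noteq> w' \<longrightarrow> stake n w \<noteq> stake n w'"
  proof -
    have "\<exists>n. \<forall>m\<ge>n. stake m w \<noteq> stake m w'" if ne: "w \<noteq> w'" for w w' :: "bool stream"
    proof -
      obtain i where i: "w !! i \<noteq> w' !! i"
        using contrapos_nn[OF ne stream_eqI[of w w']] by blast
      have "stake m w \<noteq> stake m w'" if "m \<ge> Suc i" for m
        using i that by (metis Suc_le_lessD stake_nth)
      then show ?thesis by blast
    qed
    then obtain d where d: "\<And>w w' m. w \<noteq> w' \<Longrightarrow> m \<ge> d w w' \<Longrightarrow> stake m w \<noteq> stake m (w' :: bool stream)"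
      by metis
    let ?n = "Max (insert 0 (case_prod d ` (S \<times> S)))"
    have "d w w' \<le> ?n" if "w \<in> S" "w' \<in> S" for w w'
      using S(2) that by (intro Max_ge) auto
    then show ?thesis using d by blast
  qed
  then obtain n where n: "\<And>w w'. w \<in> S \<Longrightarrow> w' \<in> S \<Longrightarrow> w \<noteq> w' \<Longrightarrow> stake n w \<noteq> stake n w'"
    by blast
  have step: "card (?L m) + Suc C \<le> card (?L (Suc m))" if "m \<ge> n" for m
  proof -
    let ?P = "\<lambda>a. {v. a # v \<in> L \<and> length v = m}"
    have finP: "finite (?P a)" for a
      by (rule finite_subset[OF _ finite_words[of m]]) auto
    have "?L (Suc m) = (#) False ` ?P False \<union> (#) True ` ?P True" (is "_ = ?F \<union> ?T")
    proof (rule set_eqI)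
      fix v show "v \<in> ?L (Suc m) \<longleftrightarrow> v \<in> ?F \<union> ?T"
        by (cases v; cases "hd v") auto
    qed
    moreover have "card (?F \<union> ?T) = card ?F + card ?T"
      using finP by (intro card_Un_disjoint) auto
    moreover have "card ?F = card (?P False)" "card ?T = card (?P True)"
      by (simp_all add: card_image)
    ultimately have "card (?L (Suc m)) = card (?P False) + card (?P True)"
      by simp
    \<comment> \<open>The union consists of all factors of length \<open>m\<close>, the intersection
      of the left special ones, whose number is therefore the increment of the complexity.\<close>
    also have "\<dots> = card (?P False \<union> ?P True) + card (?P False \<inter> ?P True)"
      using finP by (intro card_Un_Int)
    also have "?P False \<union> ?P True = ?L m"
    proof (intro equalityI subsetI)
      fix v assume "v \<in> ?L m"
      then obtain x where x: "1 \<le> length x" "x @ v \<in> L" using left_extendable[of v 1] by auto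
      then have "x = butlast x @ [last x]" by (cases x rule: rev_cases) auto
      then have "butlast x @ (last x # v) @ [] \<in> L"
        using x(2) by (metis append.right_neutral append.assoc append_Cons append_Nil)
      then have "last x # v \<in> L" by (rule factor_closed)
      then show "v \<in> ?P False \<union> ?P True" using \<open>v \<in> ?L m\<close> by (cases "last x") auto
    next
      fix v assume "v \<in> ?P False \<union> ?P True"
      then obtain a where "[a] @ v @ [] \<in> L" "length v = m" by auto
      then show "v \<in> ?L m" using factor_closed by blast
    qed
    finally have *: "card (?L (Suc m)) = card (?L m) + card (?P False \<inter> ?P True)" .
    have "inj_on (stake m) S"
    proof (rule inj_onI, rule ccontr)
      fix w w' assume "w \<in> S" "w' \<in> S" "stake m w = stake m w'" "w \<noteq> w'"
      then show False using n that by (metis min.absorb1 take_stake)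
    qed
    then have "card (stake m ` S) = Suc C" using S by (simp add: card_image)
    moreover have "stake m ` S \<subseteq> ?P False \<inter> ?P True"
      using S(1) by (auto simp: left_special_def)
    then have "card (stake m ` S) \<le> card (?P False \<inter> ?P True)"
      using finP by (intro card_mono) auto
    ultimately show ?thesis using * by simp
  qed
  have grow: "Suc C * k \<le> card (?L (n + k))" for k
  proof (induction k)
    case (Suc k)
    then show ?case using step[of "n + k"] by simp
  qed simp
  \<comment> \<open>After \<open>C * n + 1\<close> steps the lower bound exceeds the linear upper
    bound by one.\<close>
  have "Suc C * (C * n + 1) \<le> C * (n + (C * n + 1))"
    using grow[of "C * n + 1"] linear[of "n + (C * n + 1)"] by linarith
  then show False by (simp add: algebra_simps)
qed

section \<open>Growth, recurrence and factor complexity of the fixed point\<close>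

locale aperiodic_fixed_point =
  fixes \<phi> :: "word \<Rightarrow> word" and u :: "bool stream"
  assumes morphism_\<phi>: "morphism \<phi>" and primitive_\<phi>: "primitive \<phi>"
    and fixed_point: "fixed_point \<phi> u" and aperiodic: "\<not> eventually_periodic u"
begin

sublocale nonerasing_morphism \<phi>
proof
  show "morphism \<phi>" by (rule morphism_\<phi>)
  fix a
  show "\<phi> [a] \<noteq> []"
  proof
    assume er: "\<phi> [a] = []"
    obtain n where n: "set ((\<phi> ^^ n) [a]) = {False, True}"
      using primitive_\<phi> by (auto simp: primitive_def)
    have "\<phi> [] = []"
      using morphism_\<phi> unfolding morphism_def by (metis append_Nil append_self_conv)
    then have "(\<phi> ^^ m) [] = []" for m by (induction m) auto
    then show False using n er by (cases n) (auto simp del: funpow.simps simp: funpow_Suc_right)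
  qed
qed

abbreviation "L \<equiv> factors u"

lemma funpow_fixed: "stream_image (\<phi> ^^ n) u = u"
proof -
  have "(stream_image \<phi> ^^ n) u = u"
    using fixed_point by (induction n) (auto simp: fixed_point_def)
  then show ?thesis by (simp add: stream_image_funpow)
qed

lemma image_in_factors: "v \<in> L \<Longrightarrow> \<phi> v \<in> L"
  using fixed_point unfolding factors_iff fixed_point_def by (metis stream_image_shift)

definition mixing_power :: nat where
  "mixing_power = (SOME n. \<forall>a. set ((\<phi> ^^ n) [a]) = {False, True})"

lemma mixing_power: "set ((\<phi> ^^ mixing_power) [a]) = {False, True}"
  using someI_ex[OF primitive_\<phi>[unfolded primitive_def]] unfolding mixing_power_def by blast

text \<open>Under \<open>\<phi> ^^ mixing_power\<close> the image of a letter contains both letters,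
  so this power at least doubles every length.\<close>

lemma growth: "\<exists>N. \<forall>n\<ge>N. \<forall>a. k \<le> length ((\<phi> ^^ n) [a])"
proof -
  interpret p: nonerasing_morphism "\<phi> ^^ mixing_power" by (rule funpow_morphism)
  have two: "2 \<le> length ((\<phi> ^^ mixing_power) [a])" for a
    using card_length[of "(\<phi> ^^ mixing_power) [a]"] mixing_power[of a] by simp
  have dbl: "2 * length v \<le> length ((\<phi> ^^ mixing_power) v)" for v
  proof (induction v)
    case (Cons a v)
    then show ?case using two[of a] p.image_Cons[of a v] by simp
  qed simp
  have pw: "k + 1 \<le> length ((\<phi> ^^ (mixing_power * k)) [a])" for k a
  proof (induction k)
    case (Suc k)
    have "(\<phi> ^^ (mixing_power * Suc k)) [a] = (\<phi> ^^ mixing_power) ((\<phi> ^^ (mixing_power * k)) [a])"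
      by (simp add: funpow_add)
    then show ?case using Suc dbl[of "(\<phi> ^^ (mixing_power * k)) [a]"] by simp
  qed simp
  have "k \<le> length ((\<phi> ^^ n) [a])" if "n \<ge> mixing_power * k" for n a
  proof -
    interpret q: nonerasing_morphism "\<phi> ^^ (n - mixing_power * k)" by (rule funpow_morphism)
    have "(\<phi> ^^ n) [a] = (\<phi> ^^ (n - mixing_power * k)) ((\<phi> ^^ (mixing_power * k)) [a])"
      using that by (metis comp_apply funpow_add le_add_diff_inverse2)
    then show ?thesis using q.length_image_ge[of "(\<phi> ^^ (mixing_power * k)) [a]"] pw[of k a] by simp
  qed
  then show ?thesis by blast
qed

text \<open>A prefix of \<open>u\<close> containing \<open>w\<close> lies inside
  \<open>(\<phi> ^^ n) [shd u]\<close> for large \<open>n\<close>, and \<open>shd u\<close> occurs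
  in the image of every letter under the mixing power.\<close>

lemma factor_in_letter_image:
  assumes "w \<in> L"
  shows "\<exists>n. \<forall>a. \<exists>x y. (\<phi> ^^ n) [a] = x @ w @ y"
proof -
  obtain x s where u: "u = x @- w @- s" using assms factors_iff by blast
  obtain n where n: "\<And>a. length (x @ w) \<le> length ((\<phi> ^^ n) [a])"
    using growth by blast
  interpret p: nonerasing_morphism "\<phi> ^^ n" by (rule funpow_morphism)
  define b where "b = shd u"
  have "(x @ w) @- s = u" using u by simp
  also have "u = (\<phi> ^^ n) [b] @- stream_image (\<phi> ^^ n) (stl u)"
    using funpow_fixed[of n] p.stream_image_Stream[of b "stl u"] by (simp add: b_def)
  finally obtain y where y: "(\<phi> ^^ n) [b] = (x @ w) @ y"
    using n by (rule shift_eq_shiftD)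
  have "\<exists>x y. (\<phi> ^^ (n + mixing_power)) [a] = x @ w @ y" for a
  proof -
    have "b \<in> set ((\<phi> ^^ mixing_power) [a])" using mixing_power by auto
    then obtain c d where "(\<phi> ^^ mixing_power) [a] = c @ [b] @ d" by (metis split_list append_Cons append_Nil)
    then have "(\<phi> ^^ (n + mixing_power)) [a] = (\<phi> ^^ n) c @ ((x @ w) @ y) @ (\<phi> ^^ n) d"
      using y by (simp add: funpow_add del: append_assoc append.simps)
    then show ?thesis by (metis append_assoc)
  qed
  then show ?thesis by blast
qed

text \<open>\<open>u\<close> is a concatenation of blocks \<open>f [a]\<close>, each containing
  \<open>w\<close>, and a window of twice the maximal block length contains a whole block.\<close>

lemma uniformly_recurrent:
  assumes "w \<in> L"
  shows "\<exists>N. \<forall>v\<in>L. N \<le> length v \<longrightarrow> (\<exists>x y. v = x @ w @ y)"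
proof -
  obtain n where n: "\<And>a. \<exists>x y. (\<phi> ^^ n) [a] = x @ w @ y"
    using factor_in_letter_image[OF assms] by blast
  define f where "f = \<phi> ^^ n"
  interpret f: nonerasing_morphism f unfolding f_def by (rule funpow_morphism)
  define M where "M = max (length (f [False])) (length (f [True]))"
  have M: "length (f [a]) \<le> M" for a by (cases a) (auto simp: M_def)
  have "\<exists>x y. v = x @ w @ y" if v: "v \<in> L" "2 * M \<le> length v" for v
  proof -
    obtain x s where u: "u = x @- v @- s" using v factors_iff by blast
    have ex: "length x \<le> length (f (stake (length x) u))"
      using f.length_image_ge[of "stake (length x) u"] by simp
    define m where "m = (LEAST m. length x \<le> length (f (stake m u)))"
    have m: "length x \<le> length (f (stake m u))" unfolding m_def using ex by (rule LeastI)
    have m': "length (f (stake m u)) \<le> length x + M"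
    proof (cases m)
      case (Suc k)
      then have "length (f (stake k u)) < length x"
        using not_less_Least[of k "\<lambda>m. length x \<le> length (f (stake m u))"] by (auto simp: m_def)
      moreover have "f (stake m u) = f (stake k u) @ f [u !! k]"
        by (simp add: Suc stake_Suc del: stake.simps)
      ultimately show ?thesis using M[of "u !! k"] by simp
    qed simp
    have u': "u = f (stake m u) @- f [u !! m] @- stream_image f (sdrop (Suc m) u)"
      using funpow_fixed[of n] f.stream_image_stake[of u "Suc m"]
      by (simp add: f_def[symmetric] stake_Suc del: stake.simps)
    obtain p where p: "f (stake m u) = x @ p" "v @- s = p @- f [u !! m] @- stream_image f (sdrop (Suc m) u)"
      using u u' shift_eq_shiftD[OF _ m] by metis
    have "length (p @ f [u !! m]) \<le> length v" using p(1) m' M[of "u !! m"] v by simp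
    then obtain r where "v = (p @ f [u !! m]) @ r"
      using shift_eq_shiftD[of "p @ f [u !! m]" _ v s] p(2) by (metis shift_append)
    moreover obtain y z where "f [u !! m] = y @ w @ z" using n f_def by blast
    ultimately have "v = (p @ y) @ w @ (z @ r)" by simp
    then show ?thesis by blast
  qed
  then show ?thesis by blast
qed

text \<open>Left extendability holds although \<open>u\<close> has a first letter: by recurrence,
  \<open>v\<close> occurs again beyond the first \<open>n\<close> letters.\<close>

sublocale language L
proof
  fix x v y :: word
  assume "x @ v @ y \<in> L"
  then obtain p s where "u = (p @ x) @- v @- (y @- s)" by (auto simp: factors_iff)
  then show "v \<in> L" unfolding factors_iff by blast
next
  fix v n
  assume "v \<in> L"
  then obtain N where N: "\<And>w. w \<in> L \<Longrightarrow> N \<le> length w \<Longrightarrow> \<exists>x y. w = x @ v @ y"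
    using uniformly_recurrent by blast
  have "stake N (sdrop n u) \<in> L" by (auto simp: factors_def)
  then obtain x y where xy: "stake N (sdrop n u) = x @ v @ y" using N by force
  have "u = (stake n u @ x) @- v @- (y @- sdrop N (sdrop n u))"
    using xy by (metis shift_append stake_sdrop append_assoc)
  then have "(stake n u @ x) @ v \<in> L"
    unfolding factors_iff by (metis shift.simps(1) shift_append)
  then show "\<exists>x. n \<le> length x \<and> x @ v \<in> L"
    by (metis le_add1 length_append length_stake)
qed

text \<open>Otherwise \<open>\<phi> [False]\<close> would commute with the image of every prefix of
  \<open>u\<close>, so that \<open>u = \<phi> [False] @- u\<close>, a periodic word.\<close>

lemma not_commute: "\<phi> [False] @ \<phi> [True] \<noteq> \<phi> [True] @ \<phi> [False]"
proof
  assume comm: "\<phi> [False] @ \<phi> [True] = \<phi> [True] @ \<phi> [False]"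
  have comm': "\<phi> [False] @ \<phi> v = \<phi> v @ \<phi> [False]" for v
  proof (induction v)
    case (Cons a v)
    have "\<phi> [False] @ \<phi> [a] = \<phi> [a] @ \<phi> [False]" using comm by (cases a) auto
    then show ?case using Cons image_Cons[of a v] by (metis append_assoc)
  qed simp
  have "u = \<phi> [False] @- u"
  proof (rule stream_eqI_prefix)
    fix n
    have u: "u = \<phi> (stake n u) @- stream_image \<phi> (sdrop n u)"
      using stream_image_stake[of u n] fixed_point by (simp add: fixed_point_def)
    have "\<phi> [False] @- u = \<phi> (stake n u) @- \<phi> [False] @- stream_image \<phi> (sdrop n u)"
      by (subst u) (metis comm' shift_append)
    moreover have "n \<le> length (\<phi> (stake n u))" using length_image_ge[of "stake n u"] by simp
    ultimately show "\<exists>v s s'. n \<le> length v \<and> u = v @- s \<and> \<phi> [False] @- u = v @- s'"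
      using u by blast
  qed
  then have "u = cycle (\<phi> [False])"
    using nonerasing by (rule eq_cycle_if_shift_eq)
  then have "u = [] @- cycle (\<phi> [False])" by simp
  then show False using aperiodic nonerasing unfolding eventually_periodic_def by blast
qed

sublocale binary_code \<phi>
  by unfold_locales (rule not_commute)

text \<open>The Morse-Hedlund argument: if every window of length \<open>n\<close> determined the
  next letter, two equal windows, which exist by finiteness, would make \<open>u\<close> eventually
  periodic.\<close>

lemma right_special_factor: "\<exists>v. length v = n \<and> (\<forall>a. v @ [a] \<in> L)"
proof (rule ccontr)
  assume no: "\<not> ?thesis"
  define w where "w i = stake n (sdrop i u)" for i
  have wa: "w i @ [u !! (i + n)] \<in> L" for i
  proof -
    have "w i @ [u !! (i + n)] = stake (Suc n) (sdrop i u)"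
      by (simp add: w_def stake_Suc sdrop_snth del: stake.simps)
    then show ?thesis unfolding factors_def by blast
  qed
  have det: "u !! (i + n) = u !! (j + n)" if "w i = w j" for i j
  proof (rule ccontr)
    assume "u !! (i + n) \<noteq> u !! (j + n)"
    then have "w i @ [a] \<in> L" for a
      using wa[of i] wa[of j] that by (cases a; cases "u !! (i + n)") auto
    then show False using no length_stake unfolding w_def by blast
  qed
  have step: "w (Suc i) = w (Suc j)" if "w i = w j" for i j
  proof -
    have "w (Suc i) = drop 1 (w i @ [u !! (i + n)])" for i
    proof -
      have "stake (Suc n) (sdrop i u) = w i @ [u !! (i + n)]"
        by (simp add: w_def stake_Suc sdrop_snth del: stake.simps)
      then show ?thesis
        using drop_stake[of 1 "Suc n" "sdrop i u"] unfolding w_def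
        by (metis Suc_eq_plus1 diff_Suc_1 sdrop_add)
    qed
    then show ?thesis using that det[OF that] by simp
  qed
  have "\<not> inj w"
  proof
    assume "inj w"
    have "range w \<subseteq> {v. length v = n}" by (auto simp: w_def)
    then have "finite (range w)" using finite_words by (rule finite_subset)
    then have "finite (UNIV :: nat set)" using \<open>inj w\<close> by (rule finite_imageD)
    then show False by simp
  qed
  then obtain i j where ij: "i < j" "w i = w j"
    using linorder_injI[of w] by blast
  have all: "w (i + k) = w (j + k)" for k
  proof (induction k)
    case 0
    then show ?case using ij by simp
  next
    case (Suc k)
    then show ?case using step[of "i + k" "j + k"] by simp
  qed
  have "sdrop i u !! k = sdrop j u !! k" for k
  proof (cases "k < n")
    case True
    have "stake n (sdrop i u) ! k = stake n (sdrop j u) ! k" using ij by (simp add: w_def)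
    then show ?thesis using True by simp
  next
    case False
    then show ?thesis using det[OF all[of "k - n"]] by (simp add: sdrop_snth)
  qed
  then have eq: "sdrop i u = sdrop j u" by (rule stream_eqI)
  define p where "p = stake (j - i) (sdrop i u)"
  have "sdrop i u = p @- sdrop i u"
  proof -
    have "sdrop i u = p @- sdrop (j - i) (sdrop i u)" unfolding p_def by (rule stake_sdrop[symmetric])
    also have "sdrop (j - i) (sdrop i u) = sdrop j u" using ij by simp
    finally show ?thesis using eq by simp
  qed
  moreover have "p \<noteq> []" using ij by (simp add: p_def)
  ultimately have "u = stake i u @- cycle p" "p \<noteq> []"
    using eq_cycle_if_shift_eq stake_sdrop by metis+
  then show False using aperiodic unfolding eventually_periodic_def by blast
qed

text \<open>Cut \<open>u\<close> into blocks of length at least \<open>n\<close> and at most a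
  constant times \<open>n\<close>. A factor of length \<open>n\<close> lies in two consecutive
  blocks, so it is determined by two letters and a starting position.\<close>

lemma linear_complexity: "\<exists>C. \<forall>n>0. card {v \<in> L. length v = n} \<le> C * n"
proof -
  define l where "l n = length ((\<phi> ^^ n) [False]) + length ((\<phi> ^^ n) [True])" for n
  have l_ge: "length ((\<phi> ^^ n) [a]) \<le> l n" for n a by (cases a) (auto simp: l_def)
  \<comment> \<open>Both letters occur in the mixing image, so even the shorter block is at least as
    long as both earlier blocks together.\<close>
  have l_le: "l n \<le> length ((\<phi> ^^ (n + mixing_power)) [a])" for n a
  proof -
    interpret f: nonerasing_morphism "\<phi> ^^ n" by (rule funpow_morphism)
    have "False \<in> set ((\<phi> ^^ mixing_power) [a])" "True \<in> set ((\<phi> ^^ mixing_power) [a])" using mixing_power by auto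
    then obtain x y where xy: "(\<phi> ^^ mixing_power) [a] = x @ [False] @ y" "True \<in> set x \<or> True \<in> set y"
      by (metis append_Cons append_Nil in_set_conv_decomp Un_iff set_append list.set(2) insert_iff)
    have "length ((\<phi> ^^ n) [True]) \<le> length ((\<phi> ^^ n) v)" if "True \<in> set v" for v
    proof -
      have "\<exists>x y. v = x @ [True] @ y" using that by (metis split_list append_Cons append_Nil)
      then show ?thesis by (auto simp del: append.simps)
    qed
    then have "length ((\<phi> ^^ n) [True]) \<le> length ((\<phi> ^^ n) x) + length ((\<phi> ^^ n) y)"
      using xy(2) by fastforce
    then show ?thesis using xy(1) by (simp add: funpow_add l_def del: append.simps)
  qed
  have l_Suc: "l (Suc n) \<le> l 1 * l n" for n
  proof -
    interpret f: nonerasing_morphism "\<phi> ^^ n" by (rule funpow_morphism)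
    have "length ((\<phi> ^^ n) v) \<le> length v * l n" for v
    proof (induction v)
      case (Cons a v)
      then show ?case using f.image_Cons[of a v] l_ge[of n a] by simp
    qed simp
    then have "length ((\<phi> ^^ Suc n) [a]) \<le> length (\<phi> [a]) * l n" for a
      by (simp add: funpow_Suc_right del: funpow.simps)
    from this[of False] this[of True] show ?thesis
      unfolding l_def[of "Suc n"] l_def[of 1] by (simp add: algebra_simps)
  qed
  have l_add: "l (n + k) \<le> l 1 ^ k * l n" for n k
  proof (induction k)
    case (Suc k)
    have "l (n + Suc k) \<le> l 1 * l (n + k)" using l_Suc[of "n + k"] by simp
    also have "\<dots> \<le> l 1 * (l 1 ^ k * l n)" using Suc by (rule mult_left_mono) simp
    finally show ?case by (simp add: mult.assoc)
  qed simp
  \<comment> \<open>The summand 2 is \<open>l 0\<close>, which settles the case \<open>N = 0\<close>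
    below.\<close>
  define Q where "Q = l 1 + 2"
  define C where "C = 12 * (l 1 ^ mixing_power * Q)"
  have "card {v \<in> L. length v = n} \<le> C * n" if "n > 0" for n
  proof -
    obtain N0 where "n \<le> l N0" using growth[of n] l_ge le_trans by blast
    define N where "N = (LEAST N. n \<le> l N)"
    have N: "n \<le> l N" unfolding N_def using \<open>n \<le> l N0\<close> by (rule LeastI)
    have lN: "l N \<le> Q * n"
    proof (cases N)
      case 0
      then show ?thesis using that by (simp add: l_def Q_def)
    next
      case (Suc k)
      then have "l k < n" using not_less_Least[of k "\<lambda>N. n \<le> l N"] by (auto simp: N_def)
      have "l N \<le> l 1 * l k" using l_Suc[of k] Suc by simp
      also have "\<dots> \<le> l 1 * n" using \<open>l k < n\<close> by (intro mult_le_mono2) simp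
      also have "\<dots> \<le> Q * n" unfolding Q_def by (intro mult_le_mono1) simp
      finally show ?thesis .
    qed
    define f where "f = \<phi> ^^ (N + mixing_power)"
    define K where "K = l (N + mixing_power)"
    interpret f: nonerasing_morphism f unfolding f_def by (rule funpow_morphism)
    have short: "n \<le> length (f [a])" for a
      using N l_le[of N a] by (simp add: f_def)
    have fK: "length (f [a]) \<le> K" for a using l_ge by (simp add: f_def K_def)
    have cover: "{v \<in> L. length v = n} \<subseteq>
      (\<lambda>(a, b, i). take n (drop i (f [a, b]))) ` (UNIV \<times> UNIV \<times> {..<K})"
    proof
      fix v assume "v \<in> {v \<in> L. length v = n}"
      then obtain x s where u: "u = x @- v @- s" and v: "length v = n"
        using factors_iff by blast
      have ex: "length x < length (f (stake (Suc (length x)) u))"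
        using f.length_image_ge[of "stake (Suc (length x)) u"] by (simp del: stake.simps)
      \<comment> \<open>\<open>m\<close> indexes the block in which the occurrence of
        \<open>v\<close> starts.\<close>
      define m where "m = (LEAST m. length x < length (f (stake (Suc m) u)))"
      have m: "length x < length (f (stake (Suc m) u))" unfolding m_def using ex by (rule LeastI)
      have m': "length (f (stake m u)) \<le> length x"
      proof (cases m)
        case (Suc k)
        then show ?thesis
          using not_less_Least[of k "\<lambda>m. length x < length (f (stake (Suc m) u))"]
          by (auto simp: m_def not_less simp del: stake.simps)
      qed simp
      let ?ab = "[u !! m, u !! Suc m]"
      have u': "u = f (stake m u) @- f ?ab @- stream_image f (sdrop (Suc (Suc m)) u)"
        using funpow_fixed[of "N + mixing_power"] f.stream_image_stake[of u "Suc (Suc m)"]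
          f.image_append[of "[u !! m]" "[u !! Suc m]"]
        by (simp add: f_def[symmetric] stake_Suc del: stake.simps)
      obtain p where p: "x = f (stake m u) @ p" "f ?ab @- stream_image f (sdrop (Suc (Suc m)) u) = p @- v @- s"
        using u u' shift_eq_shiftD[OF _ m'] by metis
      have "length p < length (f [u !! m])"
        using m p(1) by (simp add: stake_Suc del: stake.simps)
      moreover have fab: "f ?ab = f [u !! m] @ f [u !! Suc m]"
        using f.image_append[of "[u !! m]" "[u !! Suc m]"] by simp
      ultimately have "length (p @ v) \<le> length (f ?ab)"
        using short[of "u !! Suc m"] v by simp
      then obtain r where "f ?ab = (p @ v) @ r"
        using shift_eq_shiftD[of "p @ v" s "f ?ab"] p(2) by (metis shift_append)
      then have "v = take n (drop (length p) (f ?ab))" using v by simp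
      moreover have "length p < K"
        using \<open>length p < length (f [u !! m])\<close> fK[of "u !! m"] by simp
      ultimately show "v \<in> (\<lambda>(a, b, i). take n (drop i (f [a, b]))) ` (UNIV \<times> UNIV \<times> {..<K})"
        by (intro image_eqI[of _ _ "(u !! m, u !! Suc m, length p)"]) auto
    qed
    have "card {v \<in> L. length v = n} \<le> card ((UNIV :: bool set) \<times> (UNIV :: bool set) \<times> {..<K})"
      using cover by (rule surj_card_le[rotated]) simp
    also have "\<dots> = 4 * K" by (simp add: card_cartesian_product card_UNIV_bool)
    also have "K \<le> l 1 ^ mixing_power * l N" unfolding K_def by (rule l_add)
    also have "\<dots> \<le> l 1 ^ mixing_power * (Q * n)" using lN by simp
    finally show ?thesis by (simp add: C_def)
  qed
  then show ?thesis by blast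
qed

lemma finite_left_special_L: "finite (left_special L)"
  using linear_complexity finite_left_special by metis

end

text \<open>Koenig's lemma for the binary tree \<open>T\<close>: each chosen node keeps arbitrarily
  long extensions in \<open>T\<close>.\<close>

lemma exists_branch:
  fixes T :: "word set"
  assumes prefix: "\<And>v y. v @ y \<in> T \<Longrightarrow> v \<in> T" and long: "\<And>n. \<exists>v \<in> T. n \<le> length v"
  shows "\<exists>w. \<forall>n. stake n w \<in> T"
proof -
  let ?P = "\<lambda>v. \<forall>m. \<exists>y. m \<le> length y \<and> v @ y \<in> T"
  have step: "\<exists>a. ?P (v @ [a])" if P: "?P v" for v
  proof (rule ccontr)
    assume "\<not> ?thesis"
    then obtain m where m: "\<And>a y. m a \<le> length y \<Longrightarrow> v @ [a] @ y \<notin> T"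
      by (metis append_assoc)
    obtain y where y: "Suc (max (m False) (m True)) \<le> length y" "v @ y \<in> T"
      using P by blast
    then obtain a y' where "y = a # y'" by (cases y) auto
    then show False using y m[of a y'] by (cases a) auto
  qed
  have "?P []" using long by force
  define g where "g = rec_nat [] (\<lambda>_ v. v @ [SOME a. ?P (v @ [a])])"
  have g: "?P (g n) \<and> length (g n) = n" for n
  proof (induction n)
    case 0
    then show ?case using \<open>?P []\<close> by (simp add: g_def)
  next
    case (Suc n)
    then have "?P (g n @ [SOME a. ?P (g n @ [a])])"
      using someI_ex[OF step] by blast
    then show ?case using Suc by (simp add: g_def)
  qed
  have g_Suc: "\<exists>a. g (Suc n) = g n @ [a]" for n by (auto simp: g_def)
  define w where "w = smap (\<lambda>n. g (Suc n) ! n) nats"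
  have nats: "nats !! n = n" for n by (induction n) auto
  have "stake n w = g n" for n
  proof (induction n)
    case 0
    then show ?case using g[of 0] by simp
  next
    case (Suc n)
    obtain a where a: "g (Suc n) = g n @ [a]" using g_Suc by blast
    then have "w !! n = a" using g[of n] nats by (simp add: w_def nth_append del: snth_siterate)
    then show ?case using Suc a by (simp add: stake_Suc del: stake.simps)
  qed
  moreover have "g n \<in> T" for n using g[of n] prefix by blast
  ultimately show ?thesis by metis
qed

subsection \<open>The Thue--Morse morphism\<close>

lemma thue_morse_Nil [simp]: "thue_morse [] = []"
  and thue_morse_Cons [simp]: "thue_morse (a # w) = a # (\<not> a) # thue_morse w"
  and thue_morse_append [simp]: "thue_morse (v @ w) = thue_morse v @ thue_morse w"
  by (simp_all add: thue_morse_def)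

lemma length_thue_morse [simp]: "length (thue_morse w) = 2 * length w"
  by (induction w) auto

lemma compl_thue_morse [simp]: "compl (thue_morse w) = thue_morse (compl w)"
  by (induction w) auto

lemma rev_thue_morse: "rev (thue_morse w) = thue_morse (rev (compl w))"
  by (induction w) auto

lemma thue_morse_word_power [simp]: "thue_morse (word_power w n) = word_power (thue_morse w) n"
  by (induction n) auto

lemma thue_morse_inj: "thue_morse v = thue_morse w \<Longrightarrow> v = w"
proof (induction v arbitrary: w)
  case Nil
  then show ?case by (cases w) auto
next
  case (Cons a v)
  then show ?case by (cases w) auto
qed

lemma nth_thue_morse: "i < length w \<Longrightarrow> thue_morse w ! (2 * i + 1) \<longleftrightarrow> \<not> thue_morse w ! (2 * i)"
proof (induction w arbitrary: i)
  case (Cons a w)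
  then show ?case by (cases i) auto
qed simp

lemma nth_thue_morse_replicate: "j < 2 * n \<Longrightarrow> thue_morse (replicate n False) ! j \<longleftrightarrow> odd j"
proof (induction n arbitrary: j)
  case (Suc n)
  then show ?case by (cases j; cases "j - 1") auto
qed simp

lemma word_power_add: "word_power w (m + n) = word_power w m @ word_power w n"
  by (induction m) auto

lemma nth_word_power: "j < n * length w \<Longrightarrow> word_power w n ! j = w ! (j mod length w)"
proof (induction n arbitrary: j)
  case (Suc n)
  show ?case
  proof (cases "j < length w")
    case False
    then show ?thesis using Suc by (simp add: nth_append mod_if)
  qed (simp add: nth_append)
qed simp

text \<open>The mirror image of \<open>thue_morse t\<close> is
  \<open>thue_morse (rev (compl t))\<close>, so by injectivity a palindrome
  \<open>thue_morse t\<close> comes from an antipalindrome \<open>t\<close>, whose complement is its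
  mirror image.\<close>

lemma A2_representation_of_palindrome:
  assumes "rev (thue_morse t) = thue_morse t" "t \<noteq> []"
    and "\<psi> [False] = thue_morse t @ word_power (compl (thue_morse t) @ thue_morse t) k"
    and "\<psi> [True] = word_power (compl (thue_morse t) @ thue_morse t) h @ compl (thue_morse t)"
  shows "antipalindrome t \<and> A2_representation \<psi> t k h"
proof -
  have t: "rev (compl t) = t" using assms(1) by (simp add: rev_thue_morse thue_morse_inj)
  then have "compl t = rev t" by (metis rev_rev_ident)
  then show ?thesis
    using assms t by (simp add: antipalindrome_def exchange_rev_conv A2_representation_def)
qed

subsection \<open>Fixed points with palindromes and antipalindromes\<close>

locale symmetric_fixed_point = aperiodic_fixed_point +
  assumes palindromes: "infinite {w \<in> factors u. palindrome w}"
    and antipalindromes: "infinite {w \<in> factors u. antipalindrome w}"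
begin

text \<open>By uniform recurrence a long palindromic factor contains \<open>v\<close>, hence also
  its reversal.\<close>

lemma rev_in_factors:
  assumes "v \<in> L"
  shows "rev v \<in> L"
proof -
  obtain N where N: "\<And>w. w \<in> L \<Longrightarrow> N \<le> length w \<Longrightarrow> \<exists>x y. w = x @ v @ y"
    using uniformly_recurrent[OF assms] by blast
  obtain w where w: "w \<in> L" "rev w = w" "N \<le> length w"
    using exists_long_word[OF palindromes, of N] by (auto simp: palindrome_def)
  then obtain x y where "w = x @ v @ y" using N by blast
  then have "rev y @ rev v @ rev x \<in> L" using w by (metis append_assoc rev_append)
  then show ?thesis by (rule factor_closed)
qed

text \<open>Long antipalindromes give closure under E; composing with reversal leaves the
  complement.\<close>

lemma compl_in_factors:
  assumes "v \<in> L"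
  shows "compl v \<in> L"
proof -
  obtain N where N: "\<And>w. w \<in> L \<Longrightarrow> N \<le> length w \<Longrightarrow> \<exists>x y. w = x @ v @ y"
    using uniformly_recurrent[OF assms] by blast
  obtain w where w: "w \<in> L" "rev (compl w) = w" "N \<le> length w"
    using exists_long_word[OF antipalindromes, of N]
    by (auto simp: antipalindrome_def exchange_rev_conv)
  then obtain x y where "w = x @ v @ y" using N by blast
  then have "rev (compl y) @ rev (compl v) @ rev (compl x) \<in> L"
    using w by (metis append_assoc rev_append compl_append)
  then have "rev (compl v) \<in> L" by (rule factor_closed)
  then show ?thesis using rev_in_factors by fastforce
qed

lemma scompl_left_special:
  assumes "w \<in> left_special L"
  shows "scompl w \<in> left_special L"
  unfolding left_special_def
proof (intro CollectI allI)
  fix n a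
  have "compl ((\<not> a) # stake n w) \<in> L"
    using assms by (intro compl_in_factors) (simp add: left_special_def)
  then show "a # stake n (scompl w) \<in> L" by simp
qed

text \<open>Reversed right special factors are left special and exist in every length;
  \<open>exists_branch\<close> then yields an infinite word.\<close>

lemma left_special_nonempty: "left_special L \<noteq> {}"
proof -
  have "\<exists>w. \<forall>n. stake n w \<in> {v. \<forall>a. a # v \<in> L}"
  proof (rule exists_branch)
    fix v y
    assume "v @ y \<in> {v. \<forall>a. a # v \<in> L}"
    then have "[] @ (a # v) @ y \<in> L" for a by simp
    then show "v \<in> {v. \<forall>a. a # v \<in> L}" using factor_closed by blast
  next
    fix n
    obtain v where v: "length v = n" "\<And>a. v @ [a] \<in> L" using right_special_factor by blast
    have "a # rev v \<in> L" for a using rev_in_factors[OF v(2)[of a]] by simp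
    then show "\<exists>v\<in>{v. \<forall>a. a # v \<in> L}. n \<le> length v" using v(1) by (intro bexI[of _ "rev v"]) auto
  qed
  then show ?thesis by (auto simp: left_special_def)
qed

text \<open>A common power of \<open>\<phi>\<close> fixes both words. Its multiples do too, so both
  words begin with arbitrarily long images of their common first letter.\<close>

lemma left_special_eqI:
  assumes "w \<in> left_special L" "w' \<in> left_special L" "shd w = shd w'"
  shows "w = w'"
proof -
  have per: "\<exists>r>0. (stream_image \<phi> ^^ r) w = w" if "w \<in> left_special L" for w
    using special_image_periodic(2)[OF binary_code_axioms image_in_factors
        finite_left_special_L that scompl_left_special[OF that]] .
  obtain r r' where r: "r > 0" "(stream_image \<phi> ^^ r) w = w"
    "r' > 0" "(stream_image \<phi> ^^ r') w' = w'"
    using per assms by metis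
  have fix_mult: "(stream_image \<phi> ^^ (m * n)) v = v" if "(stream_image \<phi> ^^ n) v = v" for m n v
    by (induction m) (use that in \<open>auto simp: funpow_add\<close>)
  show ?thesis
  proof (rule stream_eqI_prefix)
    fix k
    obtain N where N: "\<And>n a. n \<ge> N \<Longrightarrow> k \<le> length ((\<phi> ^^ n) [a])" using growth by blast
    define n where "n = N * (r * r')"
    have "n \<ge> N" using r by (simp add: n_def)
    interpret p: nonerasing_morphism "\<phi> ^^ n" by (rule funpow_morphism)
    have e: "stream_image (\<phi> ^^ n) w = w" "stream_image (\<phi> ^^ n) w' = w'"
      using fix_mult[OF r(2), of "N * r'"] fix_mult[OF r(4), of "N * r"]
      by (simp_all add: stream_image_funpow n_def mult.assoc mult.commute mult.left_commute)
    have "w = (\<phi> ^^ n) [shd w] @- stream_image (\<phi> ^^ n) (stl w)"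
      by (rule trans[OF e(1)[symmetric] p.stream_image_shd])
    moreover have "w' = (\<phi> ^^ n) [shd w] @- stream_image (\<phi> ^^ n) (stl w')"
      by (rule trans[OF e(2)[symmetric] p.stream_image_shd, folded assms(3)])
    moreover have "k \<le> length ((\<phi> ^^ n) [shd w])" using N \<open>n \<ge> N\<close> by blast
    ultimately show "\<exists>v s s'. k \<le> length v \<and> w = v @- s \<and> w' = v @- s'" by blast
  qed
qed

text \<open>Unique by \<open>left_special_eqI\<close>; its complement is the only other left special
  word.\<close>

definition U :: "bool stream" where
  "U = (SOME w. w \<in> left_special L \<and> \<not> shd w)"

lemma U: "U \<in> left_special L" "\<not> shd U"
proof -
  obtain w where w: "w \<in> left_special L" using left_special_nonempty by blast
  then have "\<exists>w. w \<in> left_special L \<and> \<not> shd w"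
    using scompl_left_special[OF w] by (cases "shd w") auto
  from someI_ex[OF this] show "U \<in> left_special L" "\<not> shd U" unfolding U_def by auto
qed

lemma left_special_cases:
  assumes "w \<in> left_special L"
  shows "w = U \<or> w = scompl U"
  using left_special_eqI[OF assms U(1)] left_special_eqI[OF assms scompl_left_special[OF U(1)]] U(2)
  by auto

text \<open>Applied both to \<open>\<phi>\<close> and to its conjugate by reversal. Such an
  \<open>f\<close> maps \<open>U\<close> and \<open>scompl U\<close> injectively into this pair, so
  it commutes with the complement there.\<close>

lemma image_U:
  assumes "binary_code f" "\<And>v. v \<in> L \<Longrightarrow> f v \<in> L"
  shows "stream_image f U = U \<or> stream_image f U = scompl U"
    and "stream_image f (scompl U) = scompl (stream_image f U)"
proof -
  interpret f: binary_code f by fact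
  have *: "stream_image f w \<in> left_special L" if "w \<in> left_special L" for w
    using special_image_periodic(1)[OF assms finite_left_special_L that scompl_left_special[OF that]] .
  show "stream_image f U = U \<or> stream_image f U = scompl U"
    using left_special_cases[OF *[OF U(1)]] .
  moreover have "stream_image f (scompl U) = U \<or> stream_image f (scompl U) = scompl U"
    using left_special_cases[OF *[OF scompl_left_special[OF U(1)]]] .
  moreover have "scompl U \<noteq> U" using U(2) shd_scompl by metis
  then have "stream_image f (scompl U) \<noteq> stream_image f U"
    using f.inj_stream_image by (metis injD)
  ultimately show "stream_image f (scompl U) = scompl (stream_image f U)" by auto
qed

abbreviation "\<sigma> \<equiv> \<lambda>v. compl (\<phi> (compl v))"

lemma \<phi>_U: "stream_image \<phi> U = U \<or> stream_image \<phi> U = scompl U"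
  using image_U(1)[OF binary_code_axioms image_in_factors] .

lemma \<sigma>_U: "stream_image \<sigma> U = stream_image \<phi> U"
  using scompl_stream_image[of "scompl U"] image_U(2)[OF binary_code_axioms image_in_factors] by simp

abbreviation "A \<equiv> \<phi> [False]"
abbreviation "B \<equiv> \<phi> [True]"

text \<open>The conjugate of \<open>\<phi>\<close> by reversal sends \<open>U\<close> to
  \<open>stream_image \<phi> U\<close> or to its complement. Comparing prefixes of equal length
  gives \<open>rev A = A\<close> in the first case and \<open>rev A = compl A\<close> in the second,
  and likewise for \<open>B\<close>.\<close>

lemma images_palindromic_or_antipalindromic:
  "(rev A = A \<and> rev B = B) \<or> (exchange_rev A = A \<and> exchange_rev B = B)"
proof -
  let ?\<rho> = "\<lambda>v. rev (\<phi> (rev v))"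
  interpret r: nonerasing_morphism ?\<rho> by (rule rev_morphism)
  have bc: "binary_code ?\<rho>"
    by unfold_locales (use not_commute in \<open>simp flip: rev_append\<close>)
  have im: "\<And>v. v \<in> L \<Longrightarrow> ?\<rho> v \<in> L"
    using image_in_factors rev_in_factors by blast
  let ?Y = "stream_image \<phi> U" and ?Z = "stream_image ?\<rho> U"
  have s: "stream_image \<phi> (scompl U) = scompl ?Y" "stream_image ?\<rho> (scompl U) = scompl ?Z"
    using image_U(2)[OF binary_code_axioms image_in_factors] image_U(2)[OF bc im] by auto
  have shd_U: "shd U = False" "shd (scompl U) = True" using U(2) by simp_all
  have Y: "\<exists>s. ?Y = A @- s" "\<exists>s. scompl ?Y = B @- s" "\<exists>s. ?Z = rev A @- s" "\<exists>s. scompl ?Z = rev B @- s"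
    using stream_image_shd[of U] stream_image_shd[of "scompl U"]
      r.stream_image_shd[of U] r.stream_image_shd[of "scompl U"]
    unfolding s shd_U rev.simps append_Nil by blast+
  have "?Z = ?Y \<or> ?Z = scompl ?Y"
    using \<phi>_U image_U(1)[OF bc im] by auto
  then show ?thesis
  proof
    assume "?Z = ?Y"
    then have "rev A = A" "rev B = B" using Y by (metis length_rev shift_eq_shift_iff)+
    then show ?thesis by blast
  next
    assume Z: "?Z = scompl ?Y"
    obtain s1 s2 s3 s4 where *: "?Y = A @- s1" "scompl ?Y = B @- s2" "?Z = rev A @- s3" "scompl ?Z = rev B @- s4"
      using Y by blast
    have "rev A @- s3 = compl A @- scompl s1" using * Z scompl_shift by metis
    then have "rev A = compl A" by (simp add: shift_eq_shift_iff)
    moreover have "compl (rev B) @- scompl s4 = B @- s2" using * Z by (metis scompl_shift scompl_scompl)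
    then have "compl (rev B) = B" by (simp add: shift_eq_shift_iff)
    ultimately show ?thesis by (metis exchange_rev_conv rev_rev_ident compl_rev)
  qed
qed

lemma letter_in_factors: "[a] \<in> L"
proof -
  have "a # stake 0 U \<in> L" using U(1) unfolding left_special_def by blast
  then show ?thesis by simp
qed

lemma prefix_U_in_factors:
  assumes "U = v @- T"
  shows "v \<in> L"
proof -
  have "v = stake (length v) U" using assms by (simp add: stake_shift)
  moreover have "False # stake (length v) U \<in> L" using U(1) unfolding left_special_def by blast
  ultimately have "[False] @ v @ [] \<in> L" by simp
  then show ?thesis by (rule factor_closed)
qed

lemma factor_occurs_in_U:
  assumes "v \<in> L"
  shows "\<exists>n. \<forall>i. \<exists>x y. stake n (sdrop i U) = x @ v @ y"
proof -
  obtain N where N: "\<And>w. w \<in> L \<Longrightarrow> N \<le> length w \<Longrightarrow> \<exists>x y. w = x @ v @ y"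
    using uniformly_recurrent[OF assms] by blast
  have "stake N (sdrop i U) \<in> L" for i
  proof -
    have "stake i U @ stake N (sdrop i U) @ [] \<in> L"
      by (rule prefix_U_in_factors[of _ "sdrop (i + N) U"]) (simp add: stake_sdrop)
    then show ?thesis by (rule factor_closed)
  qed
  then show ?thesis using N by (metis length_stake order_refl)
qed

text \<open>Makes \<open>begins_with_distinct_letters\<close> applicable to the tails of
  \<open>U\<close>.\<close>

lemma letter_in_tail:
  assumes "U = v @- T"
  shows "a \<in> sset T"
proof -
  have T: "T = sdrop (length v) U" using assms by (simp add: sdrop_shift)
  obtain n x y where "stake n T = x @ [a] @ y"
    using factor_occurs_in_U[OF letter_in_factors[of a]] unfolding T by blast
  then have "T = (x @ [a] @ y) @- sdrop n T" by (metis stake_sdrop)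
  then have "sset T = set (x @ [a] @ y) \<union> sset (sdrop n T)" by (metis sset_shift)
  then show ?thesis by auto
qed

end

section \<open>The images of the letters in the non-uniform case\<close>

locale nonuniform_symmetric_fixed_point = symmetric_fixed_point +
  assumes nonuniform: "\<not> uniform \<phi>"
begin

lemma length_images: "length A \<noteq> length B"
  using nonuniform by (simp add: uniform_def)

lemma word_power_images: "\<phi> (replicate n a) = word_power (\<phi> [a]) n"
proof (induction n)
  case (Suc n)
  then show ?case using image_Cons[of a "replicate n a"] by simp
qed simp

lemma begins_with_distinct_letters_aux:
  assumes eq: "stream_image \<phi> T = stream_image \<sigma> T" and "\<not> shd T" "True \<in> sset T"
  shows "\<exists>T'. T = False ## True ## T'"
proof -
  obtain i where "T !! i" using \<open>True \<in> sset T\<close> by (auto simp: sset_range)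
  then obtain n where n: "T !! n" "\<And>i. i < n \<Longrightarrow> \<not> T !! i"
    using exists_least_iff[of "\<lambda>n. T !! n"] by blast
  have "stake n T = replicate n False" by (rule nth_equalityI) (use n in auto)
  then have T: "T = replicate n False @- True ## sdrop (Suc n) T"
    using n(1) by (metis id_stake_snth_sdrop)
  have "n \<noteq> 0" using n(1) \<open>\<not> shd T\<close> by (metis snth.simps(1))
  show ?thesis
  proof (cases "n = 1")
    case True
    then show ?thesis using T by auto
  next
    case False
    then have "n \<ge> 2" using \<open>n \<noteq> 0\<close> by simp
    interpret s: nonerasing_morphism \<sigma> by (rule compl_morphism)
    have \<phi>T: "stream_image \<phi> T = word_power A n @- B @- stream_image \<phi> (sdrop (Suc n) T)"
      by (subst T) (simp add: stream_image_Stream word_power_images)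
    have "\<sigma> (replicate n False) = word_power (compl B) n"
      by (simp add: compl_replicate word_power_images)
    then have \<sigma>T: "stream_image \<sigma> T = word_power (compl B) n @- compl A @- stream_image \<sigma> (sdrop (Suc n) T)"
      by (subst T) (simp add: s.stream_image_Stream)
    have False
    proof -
      obtain J where J: "word_reversal J" "J A = A" "J B = B"
        using images_palindromic_or_antipalindromic word_reversal_rev word_reversal_exchange_rev by metis
      interpret word_reversal J by (rule J)
      \<comment> \<open>The contradiction lemma needs the longer word as its \<open>a\<close>:
        either \<open>A\<close> against \<open>compl B\<close>, or \<open>compl B\<close> against
        \<open>A\<close>.\<close>
      consider "length B < length A" | "length A < length B" using length_images by linarith
      then show False
      proof cases
        case 1
        show ?thesis
        proof (rule square_images_contradiction)
          show "word_power A n @- B @- stream_image \<phi> (sdrop (Suc n) T)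
            = word_power (compl B) n @- compl A @- stream_image \<sigma> (sdrop (Suc n) T)"
            using eq \<phi>T \<sigma>T by simp
        qed (use J nonerasing 1 \<open>n \<ge> 2\<close> in auto)
      next
        case 2
        show ?thesis
        proof (rule square_images_contradiction)
          show "word_power (compl B) n @- compl A @- stream_image \<sigma> (sdrop (Suc n) T)
            = word_power A n @- compl (compl B) @- stream_image \<phi> (sdrop (Suc n) T)"
            using eq \<phi>T \<sigma>T by simp
        qed (use J nonerasing 2 \<open>n \<ge> 2\<close> in auto)
      qed
    qed
    then show ?thesis ..
  qed
qed

lemma begins_with_distinct_letters:
  assumes eq: "stream_image \<phi> T = stream_image \<sigma> T" and letters: "\<And>a. a \<in> sset T"
  shows "\<exists>a T'. T = a ## (\<not> a) ## T'"
proof (cases "shd T")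
  case False
  then show ?thesis using begins_with_distinct_letters_aux[OF eq] letters by fastforce
next
  case True
  interpret s: nonerasing_morphism \<sigma> by (rule compl_morphism)
  have "stream_image \<phi> (scompl T) = stream_image \<sigma> (scompl T)"
    using scompl_stream_image[of T] s.scompl_stream_image[of T] eq by simp
  moreover have "True \<in> sset (scompl T)" using letters[of False] by (auto simp: scompl_def stream.set_map)
  moreover have "\<not> shd (scompl T)" using True by simp
  ultimately obtain T' where T': "scompl T = False ## True ## T'"
    using begins_with_distinct_letters_aux by blast
  have "T = True ## (\<not> True) ## scompl T'" using arg_cong[OF T', of scompl] by simp
  then show ?thesis by blast
qed

text \<open>\<open>U\<close> begins with 01 and has the same image under \<open>\<phi>\<close> and
  \<open>\<sigma>\<close>, so the two images of 01, being equally long, coincide.\<close>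

lemma AB: "A @ B = compl B @ compl A"
proof -
  interpret s: nonerasing_morphism \<sigma> by (rule compl_morphism)
  have "\<exists>a T'. U = a ## (\<not> a) ## T'"
    using letter_in_tail[of "[]" U] by (intro begins_with_distinct_letters \<sigma>_U[symmetric]) auto
  then obtain T where T: "U = False ## True ## T" using U(2) by auto
  have "A @- B @- stream_image \<phi> T = compl B @- compl A @- stream_image \<sigma> T"
    using \<sigma>_U unfolding T by (simp add: stream_image_Stream s.stream_image_Stream)
  then have "(A @ B) @- stream_image \<phi> T = (compl B @ compl A) @- stream_image \<sigma> T" by simp
  then show ?thesis by (subst (asm) shift_eq_shift_iff) auto
qed

lemma \<sigma>_thue_morse: "\<sigma> (thue_morse w) = \<phi> (thue_morse w)"
proof (induction w)
  case (Cons a w)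
  have pair: "\<phi> [a, \<not> a] = \<phi> [a] @ \<phi> [\<not> a]" "\<phi> [\<not> a, a] = \<phi> [\<not> a] @ \<phi> [a]" for a
    using image_append[of "[a]" "[\<not> a]"] image_append[of "[\<not> a]" "[a]"] by simp_all
  have "compl (\<phi> [\<not> a, a]) = \<phi> [a, \<not> a]"
  proof (cases a)
    case True
    then show ?thesis using pair[of a] arg_cong[OF AB, of compl] by simp
  next
    case False
    then show ?thesis using pair[of a] AB by simp
  qed
  moreover have "\<phi> (thue_morse (a # w)) = \<phi> [a, \<not> a] @ \<phi> (thue_morse w)"
    "\<phi> (compl (thue_morse (a # w))) = \<phi> [\<not> a, a] @ \<phi> (compl (thue_morse w))"
    using image_append[of "[a, \<not> a]" "thue_morse w"] image_append[of "[\<not> a, a]" "compl (thue_morse w)"]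
    by simp_all
  ultimately show ?case using Cons by simp
qed simp

text \<open>Pairs of letters are split off: \<open>\<phi>\<close> and \<open>\<sigma>\<close> agree
  on the removed prefix, hence on the tail, which therefore begins with two distinct letters
  again.\<close>

lemma U_thue_morse: "\<exists>w. length w = n \<and> stake (2 * n) U = thue_morse w"
proof -
  interpret s: nonerasing_morphism \<sigma> by (rule compl_morphism)
  have "\<exists>w T. length w = n \<and> U = thue_morse w @- T \<and> stream_image \<phi> T = stream_image \<sigma> T"
  proof (induction n)
    case 0
    then show ?case using \<sigma>_U by auto
  next
    case (Suc n)
    then obtain w T where w: "length w = n" "U = thue_morse w @- T" "stream_image \<phi> T = stream_image \<sigma> T"
      by blast
    then obtain a T' where T: "T = a ## (\<not> a) ## T'"
      using begins_with_distinct_letters letter_in_tail by metis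
    then have U': "U = thue_morse (w @ [a]) @- T'" using w by simp
    have "stream_image \<phi> U = \<phi> (thue_morse (w @ [a])) @- stream_image \<phi> T'"
      "stream_image \<sigma> U = \<sigma> (thue_morse (w @ [a])) @- stream_image \<sigma> T'"
      unfolding U' by (rule stream_image_shift s.stream_image_shift)+
    then have "stream_image \<phi> T' = stream_image \<sigma> T'"
      using \<sigma>_U \<sigma>_thue_morse[of "w @ [a]"] by (metis shift_left_inj)
    then show ?case using U' w(1) by (intro exI[of _ "w @ [a]"] exI[of _ T']) simp
  qed
  then show ?thesis by (metis stake_shift length_thue_morse diff_self_eq_0 take_all order_refl append_Nil2 stake.simps(1))
qed

lemma nth_U_pair: "U !! (2 * i + 1) \<longleftrightarrow> \<not> U !! (2 * i)"
proof -
  obtain w where w: "length w = Suc i" "stake (2 * Suc i) U = thue_morse w"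
    using U_thue_morse by blast
  have "stake (2 * Suc i) U ! (2 * i + 1) \<longleftrightarrow> \<not> stake (2 * Suc i) U ! (2 * i)"
    unfolding w(2) using w(1) by (intro nth_thue_morse) simp
  then show ?thesis by (simp del: stake.simps)
qed

text \<open>\<open>U\<close> is left special and begins with 0, so 00 is a factor, and by recurrence
  it occurs in \<open>U\<close> itself.\<close>

lemma U_not_alternating: "\<not> (\<forall>i. U !! i \<longleftrightarrow> odd i)"
proof
  assume alt: "\<forall>i. U !! i \<longleftrightarrow> odd i"
  have "False # stake 1 U \<in> L" using U(1) unfolding left_special_def by blast
  then have "[False, False] \<in> L" using U(2) by simp
  then obtain n x y where "stake n (sdrop 0 U) = x @ [False, False] @ y"
    using factor_occurs_in_U by blast
  then have "U = (x @ [False, False] @ y) @- sdrop n U" by (metis sdrop.simps(1) stake_sdrop)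
  also have "\<dots> = x @- False ## False ## (y @- sdrop n U)" by simp
  finally obtain T where T: "U = x @- False ## False ## T" by blast
  have "\<not> U !! length x"
    unfolding T by (simp add: shift_snth_ge)
  moreover have "\<not> U !! Suc (length x)"
    unfolding T by (subst shift_snth_ge) (simp_all add: Suc_diff_le)
  ultimately show False
    using alt[rule_format, of "length x"] alt[rule_format, of "Suc (length x)"]
    by (simp del: snth.simps)
qed

text \<open>
  An odd block length would force the letters of \<open>x @ compl x\<close>, hence those of \<open>U\<close>, to alternate.
\<close>

lemma even_length_block:
  assumes A: "A = alternating (2 * k + 1) x" and B: "B = alternating (2 * h + 1) (compl x)"
    and "x \<noteq> []"
  shows "even (length x)"
proof (rule ccontr)
  assume odd: "odd (length x)"
  define l where "l = length x"
  define z where "z = x @ compl x"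
  \<comment> \<open>\<open>A @ B\<close> consists of \<open>m\<close> copies of \<open>z\<close>.
    The different lengths of \<open>A\<close> and \<open>B\<close> give \<open>k \<noteq> h\<close>,
    so \<open>m \<ge> 2\<close>; this surplus drives the induction for \<open>all\<close>.\<close>
  define m where "m = k + h + 1"
  define Y where "Y = stream_image \<phi> U"
  have "k \<noteq> h" using length_images A B by auto
  then have "m \<ge> 2" by (simp add: m_def)
  have "l > 0" using \<open>x \<noteq> []\<close> by (simp add: l_def)
  have lz: "length z = 2 * l" by (simp add: z_def l_def)
  have "A @ B = alternating (2 * k + 1 + (2 * h + 1)) x"
    unfolding alternating_add[of "2 * k + 1"] A B by (simp del: alternating.simps)
  also have "\<dots> = alternating (2 * m) x"
    by (simp add: m_def algebra_simps del: alternating.simps)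
  finally have ABz: "A @ B = word_power z m" by (simp add: alternating_even z_def)
  have Y: "Y = U \<or> Y = scompl U" using \<phi>_U by (simp add: Y_def)
  have pair: "Y !! (2 * i + 1) \<longleftrightarrow> \<not> Y !! (2 * i)" for i
    using Y nth_U_pair[of i] by (auto simp del: snth.simps)
  have image: "\<phi> (thue_morse (replicate n False)) = word_power z (m * n)" for n
  proof (induction n)
    case (Suc n)
    have "\<phi> (thue_morse (replicate (Suc n) False)) = (A @ B) @ \<phi> (thue_morse (replicate n False))"
      using image_append[of "[False]" "True # thue_morse (replicate n False)"]
        image_append[of "[True]" "thue_morse (replicate n False)"] by simp
    then show ?case using Suc ABz word_power_add[of z m "m * n"] by simp
  qed simp
  have Yz: "Y !! j = z ! (j mod (2 * l))"
    if "stake (2 * n) U = thue_morse (replicate n False)" "j < 2 * l * (m * n)" for n j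
  proof -
    have "Y = word_power z (m * n) @- stream_image \<phi> (sdrop (2 * n) U)"
      using stream_image_stake[of U "2 * n"] unfolding Y_def that(1) image .
    then show ?thesis using that(2) nth_word_power[of j "m * n" z] by (simp add: lz mult.commute)
  qed
  have U1: "stake (2 * 1) U = thue_morse (replicate 1 False)"
    using nth_U_pair[of 0] U(2) by (simp add: numeral_2_eq_2)
  have lm: "2 * l \<le> 2 * l * (m * 1)" using \<open>m \<ge> 2\<close> by simp
  then have Y0: "Y !! j = z ! j" if "j < 2 * l" for j
    using Yz[OF U1, of j] order_less_le_trans[OF that lm] that by simp
  have zx: "z ! i = x ! i" "z ! (l + i) \<longleftrightarrow> \<not> x ! i" if "i < l" for i
    using that by (simp_all add: z_def l_def nth_append compl_def)
  \<comment> \<open>The letters of \<open>Y\<close> at \<open>2 * q\<close> and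
    \<open>2 * q + 1\<close> differ. This settles even \<open>i\<close> in the first half of
    \<open>z\<close>, and odd \<open>i\<close> in the second half, which starts at the odd position
    \<open>l\<close>.\<close>
  have x_step: "x ! Suc i \<longleftrightarrow> \<not> x ! i" if "Suc i < l" for i
  proof (cases "even i")
    case True
    then obtain q where "i = 2 * q" by blast
    then show ?thesis using pair[of q] Y0[of i] Y0[of "Suc i"] zx[of i] zx[of "Suc i"] that by simp
  next
    case False
    then have "even (l + i)" using odd by (simp add: l_def)
    then obtain q where "l + i = 2 * q" by blast
    then show ?thesis
      using pair[of q] Y0[of "l + i"] Y0[of "Suc (l + i)"] zx[of i] zx[of "Suc i"] that by simp
  qed
  have x_alt: "x ! i \<longleftrightarrow> x ! 0 \<noteq> odd i" if "i < l" for i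
    using that
  proof (induction i)
    case (Suc i)
    then show ?case using x_step[of i] by auto
  qed simp
  have z_alt: "z ! i \<longleftrightarrow> x ! 0 \<noteq> odd i" if "i < 2 * l" for i
  proof (cases "i < l")
    case True
    then show ?thesis using zx(1)[of i] x_alt[of i] by simp
  next
    case False
    then obtain j where j: "i = l + j" by (metis le_Suc_ex not_less)
    then show ?thesis using zx(2)[of j] x_alt[of j] that odd by (auto simp: l_def)
  qed
  \<comment> \<open>For \<open>n > 0\<close>, if \<open>U\<close> begins with \<open>n\<close>
    copies of 01, then \<open>Y\<close> begins with \<open>m * n\<close> copies of the alternating
    word \<open>z\<close>, covering \<open>2 * Suc n\<close> letters; as \<open>Y\<close> is
    \<open>U\<close> or its complement, the alternation of \<open>U\<close> extends.\<close>
  have all: "stake (2 * n) U = thue_morse (replicate n False)" for n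
  proof (induction n)
    case (Suc n)
    note IH = Suc
    show ?case
    proof (cases n)
      case 0
      then show ?thesis using U1 by simp
    next
      case (Suc n')
      have "2 * Suc n \<le> 2 * l * (m * n)"
      proof -
        have "Suc n \<le> 2 * n" using Suc by simp
        also have "\<dots> \<le> m * n" using \<open>m \<ge> 2\<close> by simp
        also have "\<dots> \<le> l * (m * n)" using \<open>l > 0\<close> by simp
        finally show ?thesis by simp
      qed
      then have Yj: "Y !! j \<longleftrightarrow> x ! 0 \<noteq> odd j" if "j < 2 * Suc n" for j
      proof -
        have "odd (j mod (2 * l)) = odd j" by (simp add: dvd_mod_iff)
        moreover have "Y !! j = z ! (j mod (2 * l))" using Yz[OF IH, of j] that \<open>2 * Suc n \<le> _\<close> by linarith
        ultimately show ?thesis using z_alt[of "j mod (2 * l)"] \<open>l > 0\<close> by simp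
      qed
      have Uj: "U !! j \<longleftrightarrow> odd j" if "j < 2 * Suc n" for j
      proof -
        have "\<not> U !! 0" using U(2) by simp
        then show ?thesis
          using Yj[of 0] Yj[OF that] snth_scompl[of U 0] snth_scompl[of U j] Y by fastforce
      qed
      show ?thesis
      proof (rule nth_equalityI)
        fix j assume j: "j < length (stake (2 * Suc n) U)"
        then have "stake (2 * Suc n) U ! j \<longleftrightarrow> odd j" using Uj[of j] by (simp del: stake.simps)
        then show "stake (2 * Suc n) U ! j = thue_morse (replicate (Suc n) False) ! j"
          using j nth_thue_morse_replicate[of j "Suc n"] by (simp del: stake.simps thue_morse_Cons replicate.simps)
      qed simp
    qed
  qed simp
  have "U !! i \<longleftrightarrow> odd i" for i
    using arg_cong[OF all[of "Suc i"], of "\<lambda>w. w ! i"] nth_thue_morse_replicate[of i "Suc i"]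
    by (simp del: stake.simps thue_morse_Cons replicate.simps)
  then show False using U_not_alternating by blast
qed

lemma \<phi>_thue_morse:
  assumes "\<exists>s. A = thue_morse s" "\<exists>s. B = thue_morse s"
  shows "\<exists>t'. \<phi> (thue_morse t) = thue_morse t'"
proof (induction t)
  case (Cons a t)
  obtain r where "\<phi> (thue_morse t) = thue_morse r" using Cons by blast
  moreover obtain s s' where "\<phi> [a] = thue_morse s" "\<phi> [\<not> a] = thue_morse s'"
    using assms by (cases a) auto
  moreover have "\<phi> (thue_morse (a # t)) = \<phi> [a] @ \<phi> [\<not> a] @ \<phi> (thue_morse t)"
    using image_append[of "[a]" "[\<not> a] @ thue_morse t"] image_append[of "[\<not> a]" "thue_morse t"] by simp
  ultimately have "\<phi> (thue_morse (a # t)) = thue_morse (s @ s' @ r)" by simp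
  then show ?case by blast
qed (auto intro: exI[of _ "[]"])

lemma A2_power:
  "\<exists>\<psi> \<in> {\<phi>, \<phi> ^^ 2}. \<exists>w k h. morphism \<psi> \<and> antipalindrome w \<and> A2_representation \<psi> w k h"
proof -
  obtain x k h where x: "x \<noteq> []" "A = alternating (2 * k + 1) x" "B = alternating (2 * h + 1) (compl x)"
    using append_eq_compl_append_alternating[OF AB nonerasing] by blast
  have A: "A = x @ word_power (compl x @ x) k" "A = word_power (x @ compl x) k @ x"
    unfolding x(2) by (rule alternating_odd alternating_odd')+
  have B: "B = word_power (compl x @ x) h @ compl x"
    using alternating_odd'[of h "compl x"] unfolding x(3) by simp
  have "even (length x)" using even_length_block[OF x(2,3,1)] .
  then obtain n where n: "length x = 2 * n" by blast
  obtain v where v: "length v = n" "stake (2 * n) U = thue_morse v" using U_thue_morse by blast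
  \<comment> \<open>\<open>x\<close> is a prefix of even length of
    \<open>stream_image \<phi> U\<close>, which is \<open>U\<close> or its complement, so it is an
    image under \<open>thue_morse\<close>.\<close>
  have "stake (length x) (stream_image \<phi> U) = x"
  proof -
    have "stream_image \<phi> U = x @- word_power (compl x @ x) k @- stream_image \<phi> (stl U)"
      using stream_image_shd[of U] U(2) A(1) by simp
    then show ?thesis by (simp add: stake_shift)
  qed
  moreover have "stake (length x) (scompl U) = thue_morse (compl v)" "stake (length x) U = thue_morse v"
    using n v by simp_all
  ultimately obtain t where t: "x = thue_morse t"
    using \<phi>_U by metis
  then have "t \<noteq> []" using x(1) by auto
  \<comment> \<open>\<open>A\<close> begins and ends with \<open>x\<close>, so
    \<open>J A = A\<close> begins with \<open>J x\<close>.\<close>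
  have J_x: "J x = x" if "word_reversal J" "J A = A" for J
  proof -
    interpret word_reversal J by fact
    have "x @ word_power (compl x @ x) k = J x @ J (word_power (x @ compl x) k)"
      using A that(2) by (metis J_append)
    then show ?thesis by (metis append_eq_append_conv length_J)
  qed
  show ?thesis
    using images_palindromic_or_antipalindromic
  proof
    assume "rev A = A \<and> rev B = B"
    then have "rev x = x" using J_x word_reversal_rev by blast
    then have "antipalindrome t \<and> A2_representation \<phi> t k h"
      using t A(1) B \<open>t \<noteq> []\<close> by (intro A2_representation_of_palindrome) auto
    then show ?thesis using morphism by blast
  next
    assume anti: "exchange_rev A = A \<and> exchange_rev B = B"
    then have ex: "rev (compl x) = x"
      using J_x word_reversal_exchange_rev exchange_rev_conv by metis
    have "\<exists>s. A = thue_morse s"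
      using A(1) t by (intro exI[of _ "t @ word_power (compl t @ t) k"]) simp
    moreover have "\<exists>s. B = thue_morse s"
      using B t by (intro exI[of _ "word_power (compl t @ t) h @ compl t"]) simp
    ultimately obtain t' where t': "\<phi> x = thue_morse t'"
      using \<phi>_thue_morse[of t] t by blast
    have "t' \<noteq> []" using length_image_ge[of x] x(1) t' by auto
    have compl_\<phi>x: "\<phi> (compl x) = compl (\<phi> x)"
      using \<sigma>_thue_morse[of t] t by (metis compl_compl)
    have rev_\<phi>: "rev (compl (\<phi> v)) = \<phi> (rev v)" for v
    proof (induction v)
      case (Cons a v)
      have "rev (compl (\<phi> [a])) = \<phi> [a]" using anti by (cases a) (auto simp: exchange_rev_conv)
      then show ?case using Cons image_Cons[of a v] by simp
    qed simp
    \<comment> \<open>\<open>rev (\<phi> x)\<close> is \<open>compl (\<phi> (rev x))\<close>, which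
      is \<open>compl (\<phi> (compl x))\<close> and hence \<open>\<phi> x\<close>.\<close>
    have "rev x = compl x" using ex by (metis rev_rev_ident)
    then have "rev (\<phi> x) = \<phi> x"
      using rev_\<phi>[of x] compl_\<phi>x by (metis compl_rev compl_compl)
    moreover have "(\<phi> ^^ 2) [False] = \<phi> x @ word_power (compl (\<phi> x) @ \<phi> x) k"
      using A(1) by (simp add: numeral_2_eq_2 image_word_power compl_\<phi>x)
    moreover have "(\<phi> ^^ 2) [True] = word_power (compl (\<phi> x) @ \<phi> x) h @ compl (\<phi> x)"
      using B by (simp add: numeral_2_eq_2 image_word_power compl_\<phi>x)
    ultimately have "antipalindrome t' \<and> A2_representation (\<phi> ^^ 2) t' k h"
      using t' \<open>t' \<noteq> []\<close> by (intro A2_representation_of_palindrome) auto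
    moreover have "morphism (\<phi> ^^ 2)"
      using funpow_morphism[of 2] by (simp add: nonerasing_morphism_def)
    ultimately show ?thesis by blast
  qed
qed

end

theorem theorem36:
  fixes \<phi> :: "word \<Rightarrow> word" and u :: "bool stream"
  assumes "morphism \<phi>" and "primitive \<phi>" and "\<not> uniform \<phi>"
    and "fixed_point \<phi> u" and "\<not> eventually_periodic u"
    and "infinite {w \<in> factors u. palindrome w}"
    and "infinite {w \<in> factors u. antipalindrome w}"
  shows "\<exists>\<psi> \<in> {\<phi>, \<phi> ^^ 2}. \<psi> \<in> class_A2 \<and>
    (\<exists>w k h. antipalindrome w \<and> A2_representation \<psi> w k h)"
proof -
  interpret nonuniform_symmetric_fixed_point \<phi> u
    using assms by unfold_locales
  show ?thesis using A2_power unfolding class_A2_def by blast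
qed

end
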